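(* For every constant $c>0$ there exist constants $c'>0$, $C'>0$ and $n_0$, depending only on $c$, such that for every $n\ge n_0$ the following holds. Let $P$ be a set of $n$ points and $L$ a set of $n$ lines in $\mathbb{R}^2$ with $I(P,L)\ge c\,n^{4/3}$. Then there is a subset $P'\subseteq P$ with $|P'|\ge c'n$ such that every point of $P'$ lies on at least $c'n^{1/3}$ lines of $L$, and such that for at least $c'n$ of the points $p\in P'$ there are at least $c'n^{1/3}$ pairs $\{\ell,\ell'\}$ of consecutive lines of $L$ through $p$ for which the number of points of $P$ lying between $\ell$ and $\ell'$ is at least $c'n^{2/3}$ and at most $C'n^{2/3}$.
   Context: For a finite set of points $P$ and a finite set of lines $L$ in $\mathbb{R}^2$, $I(P,L)$ denotes the number of incidences, i.e. pairs $(p,\ell)\in P\times L$ with $p\in\ell$. Two distinct lines $\ell,\ell'\in L$ through a point $p$ are consecutive if they are adjacent in the cyclic angular order (by direction) of the lines of $L$ through $p$, i.e. one of the two open double wedges with apex $p$ bounded by $\ell$ and $\ell'$ contains no point of any other line of $L$ through $p$; a point lies between $\ell$ and $\ell'$ if it lies in this open double wedge (on either side of $p$). *)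

theory Defs
  imports "HOL-Analysis.Analysis"
begin

definition is_line :: "(real ^ 2) set \<Rightarrow> bool" where
  "is_line l \<longleftrightarrow> affine l \<and> aff_dim l = 1"

definition incidences :: "(real ^ 2) set \<Rightarrow> (real ^ 2) set set \<Rightarrow> nat" where
  "incidences P L = card {(p, l). p \<in> P \<and> l \<in> L \<and> p \<in> l}"

definition double_wedge :: "real ^ 2 \<Rightarrow> real ^ 2 \<Rightarrow> real ^ 2 \<Rightarrow> (real ^ 2) set" where
  "double_wedge p u v = {p + s *\<^sub>R u + t *\<^sub>R v | s t. s * t > 0}"

text \<open>
  For distinct lines \<open>l\<close>, \<open>l'\<close> through \<open>p\<close>, with directions \<open>u\<close> and \<open>v\<close>, this set has exactly
  two elements, \<open>double_wedge p u v\<close> and \<open>double_wedge p u (- v)\<close>: rescaling a direction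
  vector does not change the double wedge except that a negative factor swaps the two.
\<close>

definition double_wedges ::
  "real ^ 2 \<Rightarrow> (real ^ 2) set \<Rightarrow> (real ^ 2) set \<Rightarrow> (real ^ 2) set set" where
  "double_wedges p l l' =
     {double_wedge p u v | u v. u \<noteq> 0 \<and> v \<noteq> 0 \<and> p + u \<in> l \<and> p + v \<in> l'}"

definition empty_double_wedges ::
  "(real ^ 2) set set \<Rightarrow> real ^ 2 \<Rightarrow> (real ^ 2) set \<Rightarrow> (real ^ 2) set \<Rightarrow> (real ^ 2) set set" where
  "empty_double_wedges L p l l' =
     {W \<in> double_wedges p l l'. \<forall>m \<in> L - {l, l'}. p \<in> m \<longrightarrow> W \<inter> m = {}}"

definition consecutive_lines ::
  "(real ^ 2) set set \<Rightarrow> real ^ 2 \<Rightarrow> (real ^ 2) set \<Rightarrow> (real ^ 2) set \<Rightarrow> bool" where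
  "consecutive_lines L p l l' \<longleftrightarrow>
     l \<in> L \<and> l' \<in> L \<and> l \<noteq> l' \<and> p \<in> l \<and> p \<in> l' \<and> empty_double_wedges L p l l' \<noteq> {}"

text \<open>
  If at least three lines of \<open>L\<close> pass through \<open>p\<close>, then two consecutive ones have exactly one
  empty double wedge, so the union below is that double wedge. If \<open>l\<close> and \<open>l'\<close> are the only
  lines of \<open>L\<close> through \<open>p\<close>, both double wedges are empty and both are counted.
\<close>

definition points_between ::
  "(real ^ 2) set \<Rightarrow> (real ^ 2) set set \<Rightarrow> real ^ 2 \<Rightarrow> (real ^ 2) set \<Rightarrow> (real ^ 2) set \<Rightarrow> (real ^ 2) set"
  where
  "points_between P L p l l' = P \<inter> \<Union> (empty_double_wedges L p l l')"

end

theory Submission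
  imports Defs
begin

text \<open>
  Dualise: the line \<open>y = m x + b\<close> becomes the point \<open>(m, b)\<close> and a point \<open>p\<close> becomes the graph of an
  affine function; vertical lines carry at most one incidence per point of \<open>P\<close> and are dropped. Two lines through
  \<open>p\<close> with consecutive slopes are then consecutive dual points on the dual line of \<open>p\<close>, and the
  points of \<open>P\<close> between them are those whose dual lines cross the segment joining these dual points. If almost all of
  the \<open>c n^(4/3)\<close> segments had at most \<open>\<epsilon> n^(2/3)\<close> crossings, the drawing they
  form on \<open>n\<close> vertices would violate the crossing lemma. Since the double wedges at a point are disjoint, each point has
  at most \<open>n^(1/3) / \<epsilon>\<close> wedges with at least \<open>\<epsilon> n^(2/3)\<close> points and
  at most \<open>n^(1/3) / C'\<close> wedges with at least \<open>C' n^(2/3)\<close> points; hence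
  \<open>\<Omega>(n)\<close> points have \<open>\<Omega>(n^(1/3))\<close> moderate wedges.
\<close>

section \<open>Edges of plane drawings\<close>

lemma meet_on_interval:
  fixes f g :: "real \<Rightarrow> real"
  assumes cont: "continuous_on {x..y} f" "continuous_on {x..y} g"
    and "x \<le> y" and ends: "f x < g x \<and> g y \<le> f y \<or> g x \<le> f x \<and> f y < g y"
  obtains z where "x \<le> z" "z \<le> y" "f z = g z"
proof -
  have c: "continuous_on {x..y} (\<lambda>t. f t - g t)" "continuous_on {x..y} (\<lambda>t. g t - f t)"
    using cont by (auto intro!: continuous_intros)
  from ends show ?thesis
  proof
    assume "f x < g x \<and> g y \<le> f y"
    then have "\<exists>z. x \<le> z \<and> z \<le> y \<and> f z - g z = 0"
      using c \<open>x \<le> y\<close> by (intro IVT') auto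
    then show ?thesis using that by auto
  next
    assume "g x \<le> f x \<and> f y < g y"
    then have "\<exists>z. x \<le> z \<and> z \<le> y \<and> g z - f z = 0"
      using c \<open>x \<le> y\<close> by (intro IVT') auto
    then show ?thesis using that by auto
  qed
qed

lemma le_at_left_end:
  fixes f g :: "real \<Rightarrow> real"
  assumes cont: "continuous_on {a..b} f" "continuous_on {a..b} g" and "a < b"
    and less: "\<And>x. a < x \<Longrightarrow> x < b \<Longrightarrow> f x < g x"
  shows "f a \<le> g a"
proof (rule ccontr)
  assume "\<not> f a \<le> g a"
  then have pos: "0 < f a - g a" by simp
  have "continuous_on {a..b} (\<lambda>t. f t - g t)"
    using cont by (auto intro!: continuous_intros)
  then obtain d where "d > 0" and d: "\<And>x. x \<in> {a..b} \<Longrightarrow> dist x a < d \<Longrightarrow> dist (f x - g x) (f a - g a) < f a - g a"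
    using pos \<open>a < b\<close> unfolding continuous_on_iff by (metis atLeastAtMost_iff less_eq_real_def)
  define x where "x = a + min (d / 2) ((b - a) / 2)"
  have x: "a < x" "x < b" "dist x a < d"
    using \<open>d > 0\<close> \<open>a < b\<close> by (auto simp: x_def dist_real_def min_def field_simps)
  have "dist (f x - g x) (f a - g a) < f a - g a" using d x by simp
  with less[OF x(1,2)] show False by (simp add: dist_real_def)
qed

text \<open>Edges are x-monotone arcs, encoded as function graphs over intervals. Planarity
  arguments thus become comparisons of real functions, with the intermediate value theorem in place
  of curve topology. Crossings are still allowed; \<open>simple\<close> forbids only two edges with
  the same ends.\<close>

locale monotone_drawing =
  fixes V :: "(real \<times> real) set" and E :: "'e set"
    and lo hi :: "'e \<Rightarrow> real" and h :: "'e \<Rightarrow> real \<Rightarrow> real"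
  assumes finite_V: "finite V" and finite_E: "finite E"
    and lo_less_hi: "e \<in> E \<Longrightarrow> lo e < hi e"
    and cont: "e \<in> E \<Longrightarrow> continuous_on {lo e..hi e} (h e)"
    and left_in: "e \<in> E \<Longrightarrow> (lo e, h e (lo e)) \<in> V"
    and right_in: "e \<in> E \<Longrightarrow> (hi e, h e (hi e)) \<in> V"
    and vertex_free: "e \<in> E \<Longrightarrow> (x, y) \<in> V \<Longrightarrow> lo e < x \<Longrightarrow> x < hi e \<Longrightarrow> y \<noteq> h e x"
    and simple: "e \<in> E \<Longrightarrow> f \<in> E \<Longrightarrow> lo e = lo f \<Longrightarrow> h e (lo e) = h f (lo f) \<Longrightarrow>
      hi e = hi f \<Longrightarrow> h e (hi e) = h f (hi f) \<Longrightarrow> e = f"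
begin

definition crosses :: "'e \<Rightarrow> 'e \<Rightarrow> bool" where
  "crosses e f \<longleftrightarrow> e \<noteq> f \<and> (\<exists>x. lo e < x \<and> x < hi e \<and> lo f < x \<and> x < hi f \<and> h e x = h f x)"

definition same_start :: "'e \<Rightarrow> 'e \<Rightarrow> bool" where
  "same_start e f \<longleftrightarrow> lo e = lo f \<and> h e (lo e) = h f (lo f)"

text \<open>Heights are compared over the common open range only: the relation is vacuous for edges
  with disjoint ranges, and the edges may meet at a shared end.\<close>

definition under :: "'e \<Rightarrow> 'e \<Rightarrow> bool" where
  "under f e \<longleftrightarrow> (\<forall>x. lo f < x \<and> x < hi f \<and> lo e < x \<and> x < hi e \<longrightarrow> h f x < h e x)"

text \<open>Neighbours in the fan of edges leaving one left end: \<open>f\<close> comes directly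
  below \<open>e\<close>.\<close>

definition wedge :: "'e \<Rightarrow> 'e \<Rightarrow> bool" where
  "wedge f e \<longleftrightarrow> f \<in> E \<and> e \<in> E \<and> same_start f e \<and> under f e \<and>
    \<not> (\<exists>g\<in>E. same_start g e \<and> under f g \<and> under g e)"

text \<open>Vertices in the sector right of the apex, up to the end of the shorter edge. The sector
  is closed because that end may be its only vertex.\<close>

definition wedge_region :: "'e \<Rightarrow> 'e \<Rightarrow> (real \<times> real) set" where
  "wedge_region f e = {v \<in> V. lo e < fst v \<and> fst v \<le> hi e \<and> fst v \<le> hi f \<and>
     h f (fst v) \<le> snd v \<and> snd v \<le> h e (fst v)}"

definition nearest :: "'e \<Rightarrow> 'e \<Rightarrow> real \<times> real \<Rightarrow> bool" where
  "nearest f e w \<longleftrightarrow> w \<in> wedge_region f e \<and> (\<forall>v \<in> wedge_region f e. fst w \<le> fst v)"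

lemma cont_sub: "e \<in> E \<Longrightarrow> lo e \<le> a \<Longrightarrow> b \<le> hi e \<Longrightarrow> continuous_on {a..b} (h e)"
  by (rule continuous_on_subset[OF cont]) auto

end

section \<open>The linear edge bound for plane drawings\<close>

locale plane_drawing = monotone_drawing +
  assumes no_crossing: "e \<in> E \<Longrightarrow> f \<in> E \<Longrightarrow> \<not> crosses e f"
begin

text \<open>One of the two points may be the right end of both edges, provided the edges differ there.\<close>

lemma order_persists:
  assumes "f \<in> E" "e \<in> E" and x: "lo f < x" "x < hi f" "lo e < x" "x < hi e" and less: "h f x < h e x"
    and y: "lo f < y" "y \<le> hi f" "lo e < y" "y \<le> hi e" and ne: "y < hi f \<and> y < hi e \<or> h f y \<noteq> h e y"
  shows "h f y < h e y"
proof (rule ccontr)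
  assume neg: "\<not> h f y < h e y"
  have *: "h f z \<noteq> h e z" if "min x y \<le> z" "z \<le> max x y" for z
  proof (cases "z < hi f \<and> z < hi e")
    case True
    moreover have "lo f < z" "lo e < z" using that x y by auto
    ultimately show ?thesis
      using no_crossing[OF assms(1,2)] less unfolding crosses_def by auto
  next
    case False
    then have "z = y" using that x y by auto
    then show ?thesis using False ne by auto
  qed
  show False
  proof (cases "x \<le> y")
    case True
    show ?thesis
      by (rule meet_on_interval[of x y "h f" "h e"])
         (use True x y less neg * in \<open>auto intro!: cont_sub assms\<close>)
  next
    case False
    show ?thesis
      by (rule meet_on_interval[of y x "h f" "h e"])
         (use False x y less neg * in \<open>auto intro!: cont_sub assms\<close>)
  qed
qed

text \<open>A change of order would force a meeting point and hence a crossing, so one sample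
  abscissa decides.\<close>

lemma underI:
  assumes "f \<in> E" "e \<in> E" "lo f < x" "x < hi f" "lo e < x" "x < hi e" "h f x < h e x"
  shows "under f e"
  unfolding under_def using order_persists[OF assms] by auto

lemma under_linear:
  assumes "f \<in> E" "e \<in> E" "f \<noteq> e" and "lo f < x" "x < hi f" "lo e < x" "x < hi e"
  shows "under f e \<or> under e f"
proof -
  have "h f x \<noteq> h e x"
    using no_crossing[OF assms(1,2)] assms unfolding crosses_def by auto
  then show ?thesis using underI assms by (metis linorder_neqE_linordered_idom)
qed

lemma under_linear_same_start:
  assumes "f \<in> E" "e \<in> E" "f \<noteq> e" and "same_start f e"
  shows "under f e \<or> under e f"
proof -
  obtain x where "lo e < x" "x < min (hi f) (hi e)"
    using dense[of "lo e" "min (hi f) (hi e)"] lo_less_hi assms unfolding same_start_def by fastforce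
  then show ?thesis using assms by (intro under_linear[of _ _ x]) (auto simp: same_start_def)
qed

lemma wedge_unique_upper:
  assumes "wedge f e1" "wedge f e2"
  shows "e1 = e2"
proof (rule ccontr)
  assume "e1 \<noteq> e2"
  moreover have "same_start e1 e2" "same_start e2 e1" "e1 \<in> E" "e2 \<in> E"
    using assms by (auto simp: wedge_def same_start_def)
  ultimately show False
    using under_linear_same_start[of e1 e2] assms by (auto simp: wedge_def)
qed

lemma not_under_refl: "e \<in> E \<Longrightarrow> \<not> under e e"
  using dense[OF lo_less_hi] unfolding under_def by blast

text \<open>If \<open>f1\<close> were under \<open>f2\<close>, then to the left of \<open>w\<close>
  the edge \<open>f2\<close> would be squeezed between \<open>f1\<close> and \<open>e1\<close>: at
  \<open>w\<close> it is strictly below \<open>e1\<close>, and it cannot cross \<open>e1\<close>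
  before.\<close>

lemma nearest_lower_not_under:
  assumes w1: "wedge f1 e1" "nearest f1 e1 w" "h f1 (fst w) < snd w"
    and w2: "wedge f2 e2" "nearest f2 e2 w" "h f2 (fst w) < snd w"
  shows "\<not> under f1 f2"
proof
  assume u12: "under f1 f2"
  have E: "f1 \<in> E" "e1 \<in> E" "f2 \<in> E" and lo1: "lo e1 = lo f1" "lo e2 = lo f2"
    and start1: "h e1 (lo f1) = h f1 (lo f1)"
    using w1 w2 by (auto simp: wedge_def same_start_def)
  define X where "X = fst w"
  define a where "a = max (lo f1) (lo f2)"
  have X: "lo f1 < X" "lo f2 < X" "X \<le> hi f1" "X \<le> hi e1" "X \<le> hi f2"
    "snd w \<le> h e1 X" "h f1 X < snd w" "h f2 X < snd w"
    using w1 w2 lo1 by (auto simp: nearest_def wedge_region_def X_def)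
  then have "a < X" by (simp add: a_def)
  have less1: "h f1 x < h f2 x" if "a < x" "x < X" for x
    using u12 that X by (auto simp: under_def a_def)
  have less2: "h f2 x < h e1 x" if x: "a < x" "x < X" for x
  proof (rule ccontr)
    assume neg: "\<not> h f2 x < h e1 x"
    have "f2 \<noteq> e1" using X by auto
    then have "h f2 x \<noteq> h e1 x"
      using no_crossing[of f2 e1] E x X lo1 unfolding crosses_def a_def by auto
    then have "h e1 X < h f2 X"
      using neg x X lo1 E by (intro order_persists[of e1 f2 x X]) (auto simp: a_def)
    then show False using X by simp
  qed
  have conts: "continuous_on {a..X} (h f1)" "continuous_on {a..X} (h f2)" "continuous_on {a..X} (h e1)"
    using X E lo1 by (auto intro!: cont_sub simp: a_def)
  have le1: "h f1 a \<le> h f2 a"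
    by (rule le_at_left_end[OF conts(1,2) \<open>a < X\<close> less1])
  have le2: "h f2 a \<le> h e1 a"
    by (rule le_at_left_end[OF conts(2,3) \<open>a < X\<close> less2])
  \<comment> \<open>The squeezed edge has no place to start. Further left, it would pass through the
    apex of the first wedge; further right, its left end would be a vertex nearer than
    \<open>w\<close>; at the same abscissa, it would separate the neighbours \<open>f1\<close> and
    \<open>e1\<close>.\<close>
  consider "lo f2 < lo f1" | "lo f1 < lo f2" | "lo f1 = lo f2" by linarith
  then show False
  proof cases
    case 1
    then have "h f2 (lo f1) = h f1 (lo f1)" using le1 le2 start1 by (simp add: a_def)
    then show False
      using vertex_free[OF E(3) left_in[OF E(1)]] 1 X by simp
  next
    case 2
    then have "(lo f2, h f2 (lo f2)) \<in> wedge_region f1 e1"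
      using le1 le2 X E lo1 left_in by (auto simp: wedge_region_def a_def)
    then have "X \<le> lo f2" using w1(2) by (force simp: nearest_def X_def)
    then show False using X by simp
  next
    case 3
    then have "h f2 (lo f2) = h f1 (lo f1)" using le1 le2 start1 by (simp add: a_def)
    then have "same_start f2 e1" using 3 lo1 start1 by (simp add: same_start_def)
    moreover obtain x where x: "a < x" "x < X" using dense \<open>a < X\<close> by blast
    then have "under f2 e1"
      using less2[OF x] X E lo1 by (intro underI[of _ _ x]) (auto simp: a_def)
    ultimately show False using w1(1) u12 E by (auto simp: wedge_def)
  qed
qed

lemma nearest_determines_lower:
  assumes w1: "wedge f1 e1" "nearest f1 e1 w" "h f1 (fst w) < snd w"
    and w2: "wedge f2 e2" "nearest f2 e2 w" "h f2 (fst w) < snd w"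
  shows "f1 = f2"
proof (rule ccontr)
  assume ne: "f1 \<noteq> f2"
  have E: "f1 \<in> E" "f2 \<in> E" and lo: "lo f1 < fst w" "lo f2 < fst w" "fst w \<le> hi f1" "fst w \<le> hi f2"
    using w1 w2 by (auto simp: wedge_def nearest_def wedge_region_def same_start_def)
  obtain x where "max (lo f1) (lo f2) < x" "x < fst w"
    using dense lo by (metis max_less_iff_conj)
  then have "under f1 f2 \<or> under f2 f1"
    using E ne lo by (intro under_linear[of _ _ x]) auto
  then show False using nearest_lower_not_under w1 w2 by blast
qed

text \<open>At an abscissa \<open>x\<close> where no edge of the fan has ended yet,
  \<open>under\<close> is comparison of heights. The next lower edge is the highest one below
  \<open>e\<close> at \<open>x\<close>.\<close>

lemma wedge_exists:
  assumes "e \<in> E" "g \<in> E" "same_start g e" "under g e"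
  shows "\<exists>f. wedge f e"
proof -
  define R where "R = {f \<in> E. same_start f e}"
  have fin: "finite R" and "e \<in> R" using finite_E assms by (auto simp: R_def same_start_def)
  have "Min (hi ` R) \<in> hi ` R" using fin \<open>e \<in> R\<close> by (intro Min_in) auto
  then have "lo e < Min (hi ` R)" using lo_less_hi by (force simp: R_def same_start_def)
  then obtain x where x: "lo e < x" "x < Min (hi ` R)" using dense by blast
  have xR: "lo f < x \<and> x < hi f" if "f \<in> R" for f
  proof
    show "lo f < x" using that x by (simp add: R_def same_start_def)
    have "Min (hi ` R) \<le> hi f" using that fin by simp
    then show "x < hi f" using x by simp
  qed
  have under_iff: "under f f' \<longleftrightarrow> h f x < h f' x" if "f \<in> R" "f' \<in> R" for f f'
    using xR that underI[of f f' x] by (auto simp: R_def under_def)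
  define B where "B = {f \<in> R. h f x < h e x}"
  have "g \<in> B" using assms under_iff \<open>e \<in> R\<close> by (auto simp: B_def R_def)
  moreover have "finite B" using fin by (simp add: B_def)
  ultimately have "Max ((\<lambda>f. h f x) ` B) \<in> (\<lambda>f. h f x) ` B"
    by (intro Max_in) auto
  then obtain f where f: "f \<in> B" "h f x = Max ((\<lambda>f. h f x) ` B)" by auto
  have max: "h g x \<le> h f x" if "g \<in> B" for g
    using that f(2) \<open>finite B\<close> by simp
  have fR: "f \<in> R" "h f x < h e x" using f by (auto simp: B_def)
  have "\<not> (under f g \<and> under g e)" if "g \<in> E" "same_start g e" for g
  proof
    have "g \<in> R" using that by (simp add: R_def)
    moreover assume "under f g \<and> under g e"
    ultimately have "h f x < h g x" "g \<in> B"
      using under_iff fR \<open>e \<in> R\<close> by (auto simp: B_def)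
    then show False using max by fastforce
  qed
  then have "wedge f e"
    unfolding wedge_def using fR assms under_iff[OF fR(1) \<open>e \<in> R\<close>] by (auto simp: R_def)
  then show ?thesis ..
qed

text \<open>The first right end reached, at abscissa \<open>b\<close>, lies in the closed sector:
  the order persists up to \<open>b\<close>, where the two edges can at most meet.\<close>

lemma nearest_exists:
  assumes "wedge f e"
  shows "\<exists>w. nearest f e w"
proof -
  have E: "f \<in> E" "e \<in> E" and co: "lo f = lo e" and un: "under f e"
    using assms by (auto simp: wedge_def same_start_def)
  define b where "b = min (hi f) (hi e)"
  have b: "lo e < b" "b \<le> hi f" "b \<le> hi e" using E co lo_less_hi[of e] lo_less_hi[of f] by (auto simp: b_def)
  have le: "h f b \<le> h e b"
  proof (rule ccontr)
    assume neg: "\<not> h f b \<le> h e b"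
    obtain x where x: "lo e < x" "x < b" using dense b by blast
    then have "h f x < h e x" using un co b by (auto simp: under_def)
    then have "h f b < h e b" using E x co b neg by (intro order_persists[of f e x b]) auto
    then show False using neg by simp
  qed
  have "wedge_region f e \<noteq> {}"
  proof (cases "b = hi f")
    case True
    then have "(b, h f b) \<in> wedge_region f e" using E le b right_in[of f] by (auto simp: wedge_region_def)
    then show ?thesis by auto
  next
    case False
    then have "b = hi e" by (auto simp: b_def min_def)
    then have "(b, h e b) \<in> wedge_region f e" using E le b right_in[of e] by (auto simp: wedge_region_def)
    then show ?thesis by auto
  qed
  moreover have "finite (wedge_region f e)" using finite_V by (simp add: wedge_region_def)
  ultimately have "Min (fst ` wedge_region f e) \<in> fst ` wedge_region f e" by simp
  then obtain w where "w \<in> wedge_region f e" "fst w = Min (fst ` wedge_region f e)" by auto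
  then show ?thesis
    using \<open>finite (wedge_region f e)\<close> unfolding nearest_def by (metis Min_le finite_imageI imageI)
qed

text \<open>A vertex on both sides is interior to neither edge, hence the right end of both. As the
  left ends agree too, \<open>simple\<close> identifies the edges.\<close>

lemma nearest_not_on_both:
  assumes "wedge f e" "nearest f e w"
  shows "h f (fst w) < snd w \<or> snd w < h e (fst w)"
proof (rule ccontr)
  assume "\<not> ?thesis"
  then have eq: "snd w = h f (fst w)" "snd w = h e (fst w)"
    and w: "(fst w, snd w) \<in> V" "lo e < fst w" "fst w \<le> hi e" "fst w \<le> hi f"
    using assms by (auto simp: nearest_def wedge_region_def)
  have E: "f \<in> E" "e \<in> E" and co: "lo f = lo e" "h f (lo f) = h e (lo e)" and un: "under f e"
    using assms by (auto simp: wedge_def same_start_def)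
  have "fst w = hi e" "fst w = hi f"
    using vertex_free[OF E(2) w(1)] vertex_free[OF E(1) w(1)] eq w co by fastforce+
  then have "f = e" using simple[OF E] co eq by simp
  then show False using not_under_refl un E by auto
qed

text \<open>Mirroring in the horizontal axis exchanges the lower and upper sides of wedges, which
  transfers the result on lower sides to upper sides.\<close>

lemma reflect:
  "plane_drawing ((\<lambda>v. (fst v, - snd v)) ` V) E lo hi (\<lambda>e x. - h e x)"
proof -
  interpret R: monotone_drawing "(\<lambda>v. (fst v, - snd v)) ` V" E lo hi "\<lambda>e x. - h e x"
  proof unfold_locales
    fix e x y
    assume "e \<in> E" "(x, y) \<in> (\<lambda>v. (fst v, - snd v)) ` V" "lo e < x" "x < hi e"
    then show "y \<noteq> - h e x" using vertex_free[of e x "- y"] by auto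
  next
    fix e f
    assume "e \<in> E" "f \<in> E" "lo e = lo f" "- h e (lo e) = - h f (lo f)"
      "hi e = hi f" "- h e (hi e) = - h f (hi f)"
    then show "e = f" using simple by simp
  qed (use finite_V finite_E lo_less_hi left_in right_in in \<open>force intro: continuous_on_minus cont\<close>)+
  show ?thesis
    by unfold_locales (use no_crossing in \<open>auto simp: crosses_def R.crosses_def\<close>)
qed

lemma nearest_determines_upper:
  assumes w1: "wedge f1 e1" "nearest f1 e1 w" "snd w < h e1 (fst w)"
    and w2: "wedge f2 e2" "nearest f2 e2 w" "snd w < h e2 (fst w)"
  shows "e1 = e2"
proof -
  interpret R: plane_drawing "(\<lambda>v. (fst v, - snd v)) ` V" E lo hi "\<lambda>e x. - h e x"
    by (rule reflect)
  have co: "R.same_start f g \<longleftrightarrow> same_start g f" for f g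
    by (auto simp: R.same_start_def same_start_def)
  have un: "R.under f g \<longleftrightarrow> under g f" for f g
    by (auto simp: R.under_def under_def)
  have we: "R.wedge e f" if "wedge f e" for e f
    using that unfolding R.wedge_def wedge_def co un by (auto simp: same_start_def)
  have re: "R.wedge_region e f = (\<lambda>v. (fst v, - snd v)) ` wedge_region f e" if "wedge f e" for e f
    using that unfolding R.wedge_region_def wedge_region_def wedge_def same_start_def by force
  have ne: "R.nearest e f (fst w, - snd w)" if "wedge f e" "nearest f e w" for e f
    using that unfolding R.nearest_def nearest_def re[OF that(1)] by auto
  show ?thesis
    using R.nearest_determines_lower[OF we[OF w1(1)] ne[OF w1(1,2)] _ we[OF w2(1)] ne[OF w2(1,2)]]
      w1(3) w2(3) by simp
qed

text \<open>Every edge that is not the lowest one leaving its left end forms a wedge with the next lower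
  one. Charge the wedge to its leftmost vertex: each vertex is charged at most once from above its
  lower side and at most once from below its upper side.\<close>

theorem card_edges_le: "card E \<le> 3 * card V"
proof -
  \<comment> \<open>\<open>M\<close> holds the lowest edge of each fan; \<open>A\<close> and
    \<open>B\<close>, which may overlap, hold the edges whose charged vertex is off the lower or off
    the upper side of the wedge. Each of the three sets injects into \<open>V\<close>, whence the
    factor 3.\<close>
  define M where "M = {e \<in> E. \<not> (\<exists>f. wedge f e)}"
  define F where "F e = (SOME f. wedge f e)" for e
  define W where "W e = (SOME w. nearest (F e) e w)" for e
  define A where "A = {e \<in> E. wedge (F e) e \<and> h (F e) (fst (W e)) < snd (W e)}"
  define B where "B = {e \<in> E. wedge (F e) e \<and> snd (W e) < h e (fst (W e))}"
  have near: "nearest (F e) e (W e)" if "wedge (F e) e" for e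
    using nearest_exists[OF that] unfolding W_def by (rule someI_ex)
  have "E \<subseteq> M \<union> (A \<union> B)"
  proof
    fix e assume "e \<in> E"
    show "e \<in> M \<union> (A \<union> B)"
    proof (cases "\<exists>f. wedge f e")
      case True
      then have "wedge (F e) e" unfolding F_def by (rule someI_ex)
      then show ?thesis
        using nearest_not_on_both[OF _ near] \<open>e \<in> E\<close> by (auto simp: A_def B_def)
    qed (use \<open>e \<in> E\<close> in \<open>auto simp: M_def\<close>)
  qed
  moreover have "finite (M \<union> (A \<union> B))" using finite_E by (simp add: M_def A_def B_def)
  ultimately have "card E \<le> card (M \<union> (A \<union> B))" by (rule card_mono[rotated])
  also have "\<dots> \<le> card M + (card A + card B)"
    by (meson add_left_mono card_Un_le le_trans)
  also have "\<dots> \<le> card V + (card V + card V)"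
  proof (intro add_mono)
    have "inj_on (\<lambda>e. (lo e, h e (lo e))) M"
    proof (rule inj_onI, rule ccontr)
      fix e f assume *: "e \<in> M" "f \<in> M" "(lo e, h e (lo e)) = (lo f, h f (lo f))" "e \<noteq> f"
      then have "same_start e f" "same_start f e" by (auto simp: same_start_def)
      then show False
        using under_linear_same_start[of e f] wedge_exists[of e f] wedge_exists[of f e] *
        by (auto simp: M_def)
    qed
    then show "card M \<le> card V"
      using finite_V left_in by (intro card_inj_on_le) (auto simp: M_def)
    have "inj_on W A"
    proof (rule inj_onI)
      fix e f assume *: "e \<in> A" "f \<in> A" "W e = W f"
      \<comment> \<open>For \<open>A\<close> the charge fixes the lower side of the wedge, which in
        turn fixes its upper side \<open>e\<close>; for \<open>B\<close> it fixes \<open>e\<close>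
        directly.\<close>
      then have "F e = F f"
        using nearest_determines_lower[of "F e" e "W e" "F f" f] near[of e] near[of f] by (simp add: A_def)
      then show "e = f"
        using wedge_unique_upper[of "F e" e f] * by (simp add: A_def)
    qed
    moreover have "inj_on W B"
    proof (rule inj_onI)
      fix e f assume *: "e \<in> B" "f \<in> B" "W e = W f"
      then show "e = f"
        using nearest_determines_upper[of "F e" e "W e" "F f" f] near[of e] near[of f] * by (simp add: B_def)
    qed
    moreover have "W e \<in> V" if "wedge (F e) e" for e
      using near[OF that] by (auto simp: nearest_def wedge_region_def)
    ultimately show "card A \<le> card V" "card B \<le> card V"
      using finite_V by (auto intro!: card_inj_on_le simp: A_def B_def)
  qed
  finally show ?thesis by simp
qed

end

section \<open>The crossing lemma\<close>

text \<open>Values on \<open>A\<close> are forced and all others are free. The quotient form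
  displays the probability \<open>1 / q ^ card A\<close> times the number of maps.\<close>

lemma card_PiE_zero_on:
  assumes "finite V" "A \<subseteq> V" "q > 0"
  shows "real (card {\<phi> \<in> V \<rightarrow>\<^sub>E {..<q}. \<forall>v\<in>A. \<phi> v = 0}) = real q ^ card V / real q ^ card A"
proof -
  have "{\<phi> \<in> V \<rightarrow>\<^sub>E {..<q}. \<forall>v\<in>A. \<phi> v = 0} = (\<Pi>\<^sub>E v\<in>V. if v \<in> A then {0} else {..<q})"
  proof (intro set_eqI iffI)
    fix \<phi> assume \<phi>: "\<phi> \<in> (\<Pi>\<^sub>E v\<in>V. if v \<in> A then {0} else {..<q})"
    then have "\<phi> v \<in> (if v \<in> A then {0} else {..<q})" if "v \<in> V" for v
      using that by (rule PiE_mem)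
    then have "\<phi> v < q" "v \<in> A \<Longrightarrow> \<phi> v = 0" if "v \<in> V" for v
      using that assms(3) by (force split: if_splits)+
    then show "\<phi> \<in> {\<phi> \<in> V \<rightarrow>\<^sub>E {..<q}. \<forall>v\<in>A. \<phi> v = 0}"
      using \<phi> assms(2) by (auto simp: PiE_iff)
  qed (auto simp: PiE_iff)
  then have "card {\<phi> \<in> V \<rightarrow>\<^sub>E {..<q}. \<forall>v\<in>A. \<phi> v = 0} = (\<Prod>v\<in>V. if v \<in> A then 1 else q)"
    using assms by (simp add: card_PiE if_distrib cong: if_cong)
  also have "\<dots> = (\<Prod>v\<in>V - A. q)"
    using assms by (intro prod.mono_neutral_cong_right) auto
  also have "\<dots> = q ^ (card V - card A)"
    using assms by (simp add: card_Diff_subset finite_subset)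
  finally show ?thesis
    using assms(3) card_mono[OF assms(1,2)] by (simp only: of_nat_power power_diff[of "real q"] of_nat_eq_0_iff simp_thms)
qed

text \<open>Linearity of expectation, obtained by exchanging the two sums.\<close>

lemma sum_card_zero_on:
  assumes "finite V" "finite X" "q > 0" "\<And>x. x \<in> X \<Longrightarrow> A x \<subseteq> V \<and> card (A x) = a"
  shows "(\<Sum>\<phi> \<in> V \<rightarrow>\<^sub>E {..<q}. real (card {x\<in>X. \<forall>v\<in>A x. \<phi> v = 0})) = real (card X) * real q ^ card V / real q ^ a"
proof -
  have "(\<Sum>\<phi> \<in> V \<rightarrow>\<^sub>E {..<q}. card {x\<in>X. \<forall>v\<in>A x. \<phi> v = 0})
      = (\<Sum>x\<in>X. card {\<phi> \<in> V \<rightarrow>\<^sub>E {..<q}. \<forall>v\<in>A x. \<phi> v = 0})"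
    unfolding card_eq_sum using assms by (intro sum.swap_restrict finite_PiE) auto
  then have "(\<Sum>\<phi> \<in> V \<rightarrow>\<^sub>E {..<q}. real (card {x\<in>X. \<forall>v\<in>A x. \<phi> v = 0}))
      = (\<Sum>x\<in>X. real (card {\<phi> \<in> V \<rightarrow>\<^sub>E {..<q}. \<forall>v\<in>A x. \<phi> v = 0}))"
    by (simp only: of_nat_sum[symmetric])
  also have "\<dots> = (\<Sum>x\<in>X. real q ^ card V / real q ^ a)"
    using assms by (intro sum.cong refl) (simp add: card_PiE_zero_on)
  finally show ?thesis by simp
qed

section \<open>From plane drawings to drawings with few crossings per edge\<close>

context monotone_drawing
begin

definition ends :: "'e \<Rightarrow> (real \<times> real) set" where
  "ends e = {(lo e, h e (lo e)), (hi e, h e (hi e))}"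

lemma ends_subset: "e \<in> E \<Longrightarrow> ends e \<subseteq> V"
  using left_in right_in by (simp add: ends_def)

lemma card_ends: "e \<in> E \<Longrightarrow> card (ends e) = 2"
  using lo_less_hi[of e] by (simp add: ends_def)

lemma restrict:
  assumes "V' \<subseteq> V" "E' \<subseteq> E" "\<And>e. e \<in> E' \<Longrightarrow> ends e \<subseteq> V'"
  shows "monotone_drawing V' E' lo hi h"
proof unfold_locales
  show "finite V'" "finite E'" using assms finite_V finite_E by (auto intro: finite_subset)
next
  fix e f assume "e \<in> E'" "f \<in> E'" "lo e = lo f" "h e (lo e) = h f (lo f)"
    "hi e = hi f" "h e (hi e) = h f (hi f)"
  then show "e = f" using assms(2) by (intro simple) auto
next
  fix e assume "e \<in> E'"
  then show "lo e < hi e" "continuous_on {lo e..hi e} (h e)"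
    "(lo e, h e (lo e)) \<in> V'" "(hi e, h e (hi e)) \<in> V'"
    using assms lo_less_hi cont by (auto simp: ends_def)
next
  fix e x y assume "e \<in> E'" "(x, y) \<in> V'" "lo e < x" "x < hi e"
  then show "y \<noteq> h e x" using assms(1,2) by (intro vertex_free) auto
qed

text \<open>Deleting every edge that takes part in a crossing leaves a plane drawing. There are at
  most as many such edges as ordered crossing pairs.\<close>

lemma card_edges_le_crossings:
  "card E \<le> 3 * card V + card {(e, f) \<in> E \<times> E. crosses e f}"
proof -
  define X where "X = {(e, f) \<in> E \<times> E. crosses e f}"
  have "X \<subseteq> E \<times> E" unfolding X_def by blast
  then have finX: "finite X" using finite_E by (metis finite_SigmaI finite_subset)
  interpret P: plane_drawing V "E - fst ` X" lo hi h
  proof -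
    interpret R: monotone_drawing V "E - fst ` X" lo hi h
      by (rule restrict) (use ends_subset in auto)
    show "plane_drawing V (E - fst ` X) lo hi h"
    proof unfold_locales
      fix e f assume "e \<in> E - fst ` X" "f \<in> E - fst ` X"
      then have "(e, f) \<notin> X" by force
      then show "\<not> R.crosses e f"
        using \<open>e \<in> E - fst ` X\<close> \<open>f \<in> E - fst ` X\<close> by (simp add: X_def R.crosses_def crosses_def)
    qed
  qed
  have "card E \<le> card (E - fst ` X) + card (fst ` X)"
    using diff_card_le_card_Diff[OF finite_imageI[OF finX], of E fst] by linarith
  also have "\<dots> \<le> 3 * card V + card X"
    by (intro add_mono P.card_edges_le card_image_le finX)
  finally show ?thesis unfolding X_def .
qed

text \<open>A random subset of the vertices, each taken with probability \<open>1 / q\<close>, keeps an edge with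
  probability \<open>1 / q\<^sup>2\<close> and a crossing with probability \<open>1 / q\<^sup>4\<close>; averaging over
  all maps from \<open>V\<close> to \<open>{..<q}\<close> and keeping the zero fibre realises this.\<close>

theorem card_edges_le_if_few_crossings:
  assumes disjoint_ends: "\<And>e f. e \<in> E \<Longrightarrow> f \<in> E \<Longrightarrow> crosses e f \<Longrightarrow> ends e \<inter> ends f = {}"
    and few: "\<And>e. e \<in> E \<Longrightarrow> real (card {f \<in> E. crosses e f}) \<le> k"
    and q: "q > 0" "2 * k \<le> (real q)\<^sup>2"
  shows "real (card E) \<le> 6 * real q * real (card V)"
proof -
  define X where "X = {(e, f) \<in> E \<times> E. crosses e f}"
  define \<Phi> where "\<Phi> = V \<rightarrow>\<^sub>E {..<q}"
  define N where "N = real q ^ card V"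
  have "X \<subseteq> E \<times> E" unfolding X_def by blast
  then have finX: "finite X" using finite_E by (metis finite_SigmaI finite_subset)
  have N: "N > 0" using q by (simp add: N_def)
  have X_le: "real (card X) \<le> k * real (card E)"
  proof -
    have "X = (SIGMA e:E. {f \<in> E. crosses e f})" by (auto simp: X_def)
    then have "real (card X) = (\<Sum>e\<in>E. real (card {f \<in> E. crosses e f}))"
      using finite_E by simp
    also have "\<dots> \<le> (\<Sum>e\<in>E. k)" by (intro sum_mono few)
    finally show ?thesis by (simp add: mult.commute)
  qed
  \<comment> \<open>The weak bound for the subdrawing induced on the zero fibre. The singleton
    \<open>{u}\<close> gives vertices the same shape as edges and crossings, so that one averaging
    lemma serves all three.\<close>
  have step: "real (card {e\<in>E. \<forall>v\<in>ends e. \<phi> v = 0})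
      \<le> 3 * real (card {u\<in>V. \<forall>v\<in>{u}. \<phi> v = 0})
        + real (card {x\<in>X. \<forall>v\<in>ends (fst x) \<union> ends (snd x). \<phi> v = 0})" for \<phi> :: "real \<times> real \<Rightarrow> nat"
  proof -
    interpret R: monotone_drawing "{v\<in>V. \<phi> v = 0}" "{e\<in>E. \<forall>v\<in>ends e. \<phi> v = 0}" lo hi h
      by (rule restrict) (use ends_subset in auto)
    have "{(e, f) \<in> {e\<in>E. \<forall>v\<in>ends e. \<phi> v = 0} \<times> {e\<in>E. \<forall>v\<in>ends e. \<phi> v = 0}. R.crosses e f}
        = {x\<in>X. \<forall>v\<in>ends (fst x) \<union> ends (snd x). \<phi> v = 0}"
      by (auto simp: X_def crosses_def R.crosses_def)
    then show ?thesis using R.card_edges_le_crossings by simp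
  qed
  have "(\<Sum>\<phi>\<in>\<Phi>. real (card {e\<in>E. \<forall>v\<in>ends e. \<phi> v = 0}))
      \<le> (\<Sum>\<phi>\<in>\<Phi>. 3 * real (card {u\<in>V. \<forall>v\<in>{u}. \<phi> v = 0})
        + real (card {x\<in>X. \<forall>v\<in>ends (fst x) \<union> ends (snd x). \<phi> v = 0}))"
    by (intro sum_mono step)
  also have "\<dots> = 3 * (\<Sum>\<phi>\<in>\<Phi>. real (card {u\<in>V. \<forall>v\<in>{u}. \<phi> v = 0}))
        + (\<Sum>\<phi>\<in>\<Phi>. real (card {x\<in>X. \<forall>v\<in>ends (fst x) \<union> ends (snd x). \<phi> v = 0}))"
    by (simp only: sum.distrib sum_distrib_left)
  also have "(\<Sum>\<phi>\<in>\<Phi>. real (card {e\<in>E. \<forall>v\<in>ends e. \<phi> v = 0})) = real (card E) * N / real q ^ 2"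
    unfolding \<Phi>_def N_def using finite_V finite_E q ends_subset card_ends
    by (intro sum_card_zero_on) auto
  also have "(\<Sum>\<phi>\<in>\<Phi>. real (card {u\<in>V. \<forall>v\<in>{u}. \<phi> v = 0})) = real (card V) * N / real q ^ 1"
    unfolding \<Phi>_def N_def using finite_V q by (intro sum_card_zero_on) auto
  also have "(\<Sum>\<phi>\<in>\<Phi>. real (card {x\<in>X. \<forall>v\<in>ends (fst x) \<union> ends (snd x). \<phi> v = 0}))
      = real (card X) * N / real q ^ 4"
    unfolding \<Phi>_def N_def
  proof (intro sum_card_zero_on finite_V finX q)
    fix x assume "x \<in> X"
    then have "fst x \<in> E" "snd x \<in> E" "crosses (fst x) (snd x)" by (auto simp: X_def)
    \<comment> \<open>Crossing edges have four distinct ends; this gives the exponent 4.\<close>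
    then show "ends (fst x) \<union> ends (snd x) \<subseteq> V \<and> card (ends (fst x) \<union> ends (snd x)) = 4"
      using ends_subset card_ends disjoint_ends card_Un_disjoint[of "ends (fst x)" "ends (snd x)"]
      by (auto simp: ends_def)
  qed
  finally have "N * (real (card E) / real q ^ 2) \<le>
      N * (3 * real (card V) / real q + real (card X) / real q ^ 4)"
    by (simp add: algebra_simps)
  then have "real (card E) / real q ^ 2 \<le> 3 * real (card V) / real q + real (card X) / real q ^ 4"
    by (simp only: mult_le_cancel_left_pos[OF N])
  also have "\<dots> = (3 * real q * real (card V) + real (card X) / real q ^ 2) / real q ^ 2"
    using q by (simp add: add_divide_distrib power2_eq_square power4_eq_xxxx)
  finally have "real (card E) \<le> 3 * real q * real (card V) + real (card X) / real q ^ 2"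
    using q by (simp add: divide_le_cancel)
  \<comment> \<open>There are at most \<open>k * card E\<close> crossings, and \<open>2 * k\<close>
    is at most the square of \<open>q\<close>: crossings account for at most half of the edges,
    which turns the factor 3 into 6.\<close>
  moreover have "real (card X) / real q ^ 2 \<le> real (card E) / 2"
  proof -
    have "2 * k * real (card E) \<le> real q ^ 2 * real (card E)"
      using q by (intro mult_right_mono) auto
    then have "2 * real (card X) \<le> real q ^ 2 * real (card E)" using X_le by simp
    then show ?thesis using q by (simp add: field_simps)
  qed
  ultimately show ?thesis by linarith
qed

end

section \<open>Duality\<close>

definition graph_line :: "real \<Rightarrow> real \<Rightarrow> (real ^ 2) set" where
  "graph_line m b = {x. x $ 2 = m * x $ 1 + b}"

text \<open>The line \<open>graph_line m b\<close> is dual to the point \<open>(m, b)\<close>, and the point \<open>p\<close> is dual to the graph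
  of \<open>dual_line p\<close>; duality preserves incidence.\<close>

definition dual_line :: "real ^ 2 \<Rightarrow> real \<Rightarrow> real" where
  "dual_line p x = p $ 2 - p $ 1 * x"

lemma mem_graph_line_iff: "p \<in> graph_line m b \<longleftrightarrow> b = dual_line p m"
  by (auto simp: graph_line_def dual_line_def algebra_simps)

lemma graph_line_eq_iff: "graph_line m b = graph_line m' b' \<longleftrightarrow> m = m' \<and> b = b'"
proof
  assume eq: "graph_line m b = graph_line m' b'"
  have "vector [0, b] \<in> graph_line m b" "vector [1, m + b] \<in> graph_line m b"
    by (simp_all add: graph_line_def)
  then have "vector [0, b] \<in> graph_line m' b'" "vector [1, m + b] \<in> graph_line m' b'"
    by (simp_all add: eq)
  then show "m = m' \<and> b = b'" by (simp add: graph_line_def)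
qed simp

lemma vec2_eq_iff: "(x :: real ^ 2) = y \<longleftrightarrow> x $ 1 = y $ 1 \<and> x $ 2 = y $ 2"
  by (simp add: vec_eq_iff forall_2)

text \<open>An affine basis has two points; their abscissae either agree or determine a
  slope.\<close>

lemma is_line_cases:
  assumes "is_line l"
  obtains (graph) m b where "l = graph_line m b" | (vertical) a where "l = {x. x $ 1 = a}"
proof -
  obtain B where B: "affine hull B = affine hull l" "of_nat (card B) = aff_dim l + 1"
    using aff_dim_basis_exists by blast
  then have "card B = 2" using assms by (simp add: is_line_def)
  then obtain u v where uv: "B = {u, v}" "u \<noteq> v" by (auto simp: card_2_iff)
  have l: "l = {s *\<^sub>R u + t *\<^sub>R v | s t. s + t = 1}"
    using B(1) assms affine_hull_2[of u v] by (simp add: is_line_def uv hull_same)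
  show thesis
  proof (cases "u $ 1 = v $ 1")
    case True
    have "l = {x. x $ 1 = u $ 1}"
    proof (intro set_eqI iffI)
      fix x assume "x \<in> l"
      then show "x \<in> {x. x $ 1 = u $ 1}"
        using True by (auto simp: l simp flip: distrib_right)
    next
      fix x :: "real ^ 2" assume x: "x \<in> {x. x $ 1 = u $ 1}"
      define t where "t = (x $ 2 - u $ 2) / (v $ 2 - u $ 2)"
      have "v $ 2 - u $ 2 \<noteq> 0" using True uv by (auto simp: vec2_eq_iff)
      then have "x $ 2 = u $ 2 + t * (v $ 2 - u $ 2)" by (simp add: t_def)
      then have "x = (1 - t) *\<^sub>R u + t *\<^sub>R v"
        using True x by (simp add: vec2_eq_iff algebra_simps)
      then show "x \<in> l" unfolding l by force
    qed
    then show ?thesis by (rule vertical)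
  next
    case False
    define m where "m = (v $ 2 - u $ 2) / (v $ 1 - u $ 1)"
    have m: "v $ 2 = u $ 2 + m * (v $ 1 - u $ 1)" using False by (simp add: m_def)
    have "l = graph_line m (dual_line u m)"
    proof (intro set_eqI iffI)
      fix x assume "x \<in> l"
      then obtain s t where "x = s *\<^sub>R u + t *\<^sub>R v" "s + t = 1" by (auto simp: l)
      then have "x = (1 - t) *\<^sub>R u + t *\<^sub>R v" by (simp add: eq_diff_eq)
      then have x: "x $ 1 = u $ 1 + t * (v $ 1 - u $ 1)" "x $ 2 = u $ 2 + t * (v $ 2 - u $ 2)"
        by (simp only: vector_add_component vector_scaleR_component real_scaleR_def, simp add: algebra_simps)+
      show "x \<in> graph_line m (dual_line u m)"
        unfolding graph_line_def dual_line_def mem_Collect_eq x m by (simp add: algebra_simps)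
    next
      fix x assume x: "x \<in> graph_line m (dual_line u m)"
      define t where "t = (x $ 1 - u $ 1) / (v $ 1 - u $ 1)"
      have t: "x $ 1 = u $ 1 + t * (v $ 1 - u $ 1)" using False by (simp add: t_def)
      have "x $ 2 = u $ 2 + m * (x $ 1 - u $ 1)"
        using x by (simp add: graph_line_def dual_line_def algebra_simps)
      also have "\<dots> = u $ 2 + t * (v $ 2 - u $ 2)" by (simp add: t m)
      finally have "x = (1 - t) *\<^sub>R u + t *\<^sub>R v"
        using t by (simp add: vec2_eq_iff algebra_simps)
      then show "x \<in> l" unfolding l by force
    qed
    then show ?thesis by (rule graph)
  qed
qed

section \<open>Consecutive slopes and the wedges between them\<close>

definition slopes :: "(real ^ 2) set set \<Rightarrow> real ^ 2 \<Rightarrow> real set" where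
  "slopes L p = {m. graph_line m (dual_line p m) \<in> L}"

text \<open>A slope determines the line through \<open>p\<close>, so slopes stand for the
  non-vertical lines. Their order is linear, not cyclic: the sector around the vertical direction is
  left out.\<close>

definition consecutive_slopes :: "(real ^ 2) set set \<Rightarrow> real ^ 2 \<Rightarrow> (real \<times> real) set" where
  "consecutive_slopes L p =
     {(a, b). a \<in> slopes L p \<and> b \<in> slopes L p \<and> a < b \<and> \<not> (\<exists>c \<in> slopes L p. a < c \<and> c < b)}"

text \<open>Each factor is the height of \<open>q\<close> over the line through \<open>p\<close>
  with the given slope. Opposite signs place \<open>q\<close> in the double wedge that avoids the
  vertical direction.\<close>

definition wedge_points :: "(real ^ 2) set \<Rightarrow> real ^ 2 \<Rightarrow> real \<times> real \<Rightarrow> (real ^ 2) set" where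
  "wedge_points P p ab = {q \<in> P. (dual_line q (fst ab) - dual_line p (fst ab)) *
     (dual_line q (snd ab) - dual_line p (snd ab)) < 0}"

lemma line_through_cases:
  assumes "is_line l" "l \<in> L" "p \<in> l"
  obtains (graph) c where "c \<in> slopes L p" "l = graph_line c (dual_line p c)"
    | (vertical) "l = {x. x $ 1 = p $ 1}"
  using assms(1)
proof (cases rule: is_line_cases)
  case (graph m b)
  then have "b = dual_line p m" using assms by (simp add: mem_graph_line_iff)
  then show ?thesis using graph assms that(1)[of m] by (simp add: slopes_def)
next
  case (vertical a)
  then show ?thesis using assms that(2) by auto
qed

lemma finite_slopes: "finite L \<Longrightarrow> finite (slopes L p)"
  by (rule inj_on_finite[of "\<lambda>m. graph_line m (dual_line p m)" _ L])
     (auto simp: slopes_def inj_on_def graph_line_eq_iff)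

lemma finite_consecutive_slopes: "finite L \<Longrightarrow> finite (consecutive_slopes L p)"
  by (rule finite_subset[of _ "slopes L p \<times> slopes L p"])
     (auto simp: consecutive_slopes_def finite_slopes)

lemma card_slopes_le: "finite L \<Longrightarrow> card (slopes L p) \<le> card {l \<in> L. p \<in> l}"
  by (rule card_inj_on_le[of "\<lambda>m. graph_line m (dual_line p m)"])
     (auto simp: slopes_def inj_on_def graph_line_eq_iff mem_graph_line_iff)

text \<open>The summand 1 pays for the vertical line through \<open>p\<close>.\<close>

lemma card_lines_through_le:
  assumes "finite L" "\<forall>l\<in>L. is_line l"
  shows "card {l \<in> L. p \<in> l} \<le> card (slopes L p) + 1"
proof -
  have "{l \<in> L. p \<in> l} \<subseteq> insert {x. x $ 1 = p $ 1} ((\<lambda>m. graph_line m (dual_line p m)) ` slopes L p)"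
  proof
    fix l assume "l \<in> {l \<in> L. p \<in> l}"
    then have "is_line l" "l \<in> L" "p \<in> l" using assms by auto
    then show "l \<in> insert {x. x $ 1 = p $ 1} ((\<lambda>m. graph_line m (dual_line p m)) ` slopes L p)"
      by (cases rule: line_through_cases) auto
  qed
  then have "card {l \<in> L. p \<in> l}
      \<le> card (insert {x. x $ 1 = p $ 1} ((\<lambda>m. graph_line m (dual_line p m)) ` slopes L p))"
    using finite_slopes[OF assms(1)] by (intro card_mono) auto
  also have "\<dots> \<le> Suc (card ((\<lambda>m. graph_line m (dual_line p m)) ` slopes L p))"
    by (rule card_insert_le_m1) auto
  also have "\<dots> \<le> card (slopes L p) + 1"
    using card_image_le[OF finite_slopes[OF assms(1)]] by simp
  finally show ?thesis .
qed

lemma consecutive_slopes_overlap: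
  assumes "(a, b) \<in> consecutive_slopes L p" "(c, d) \<in> consecutive_slopes L p"
    and "a < x" "x < b" "c < x" "x < d"
  shows "(a, b) = (c, d)"
proof -
  have *: "\<not> (a < c \<and> c < b)" "\<not> (a < d \<and> d < b)" "\<not> (c < a \<and> a < d)" "\<not> (c < b \<and> b < d)"
    using assms(1,2) by (auto simp: consecutive_slopes_def)
  have "a = c" "b = d" using * assms(3-) by linarith+
  then show ?thesis by simp
qed

lemma consecutive_slopes_same_fst:
  assumes "(a, b) \<in> consecutive_slopes L p" "(a, d) \<in> consecutive_slopes L p"
  shows "b = d"
proof -
  have "\<not> (a < d \<and> d < b)" "\<not> (a < b \<and> b < d)" "a < b" "a < d"
    using assms by (auto simp: consecutive_slopes_def)
  then show ?thesis by linarith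
qed

lemma card_consecutive_slopes_le:
  assumes "finite L"
  shows "card (consecutive_slopes L p) \<le> card (slopes L p)"
proof (rule card_inj_on_le[of fst])
  show "inj_on fst (consecutive_slopes L p)"
    using consecutive_slopes_same_fst by (fastforce simp: inj_on_def)
qed (auto simp: consecutive_slopes_def finite_slopes assms)

text \<open>Every slope but the largest has a successor.\<close>

lemma card_slopes_le_consecutive:
  assumes "finite L"
  shows "card (slopes L p) \<le> card (consecutive_slopes L p) + 1"
proof (cases "slopes L p = {}")
  case False
  note fin = finite_slopes[OF assms, of p]
  have "slopes L p - {Max (slopes L p)} \<subseteq> fst ` consecutive_slopes L p"
  proof
    fix a assume a: "a \<in> slopes L p - {Max (slopes L p)}"
    define B where "B = {b \<in> slopes L p. a < b}"
    have "a < Max (slopes L p)" using a Max_ge[OF fin, of a] by auto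
    then have "B \<noteq> {}" using Max_in[OF fin False] by (auto simp: B_def)
    moreover have finB: "finite B" using fin by (simp add: B_def)
    ultimately have "Min B \<in> B" by (simp add: Min_in)
    moreover have "\<not> (\<exists>c\<in>slopes L p. a < c \<and> c < Min B)"
      using Min_le[OF finB] by (force simp: B_def)
    ultimately have "(a, Min B) \<in> consecutive_slopes L p"
      using a by (auto simp: consecutive_slopes_def B_def)
    then show "a \<in> fst ` consecutive_slopes L p" by force
  qed
  then have "card (slopes L p - {Max (slopes L p)}) \<le> card (consecutive_slopes L p)"
    using finite_consecutive_slopes[OF assms] by (rule surj_card_le[rotated])
  then show ?thesis using fin by (simp add: card_Diff_singleton_if split: if_splits)
qed simp

text \<open>Turns wedge membership into a crossing of dual lines. The height difference is affine in
  \<open>x\<close>, so a sign change means a root in between; the condition on the abscissae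
  excludes constant differences, in particular \<open>q = p\<close>.\<close>

lemma wedge_points_iff:
  assumes "a < b"
  shows "q \<in> wedge_points P p (a, b) \<longleftrightarrow>
    q \<in> P \<and> q $ 1 \<noteq> p $ 1 \<and> (\<exists>x. a < x \<and> x < b \<and> dual_line q x = dual_line p x)"
proof -
  define u v where "u = q $ 2 - p $ 2" and "v = q $ 1 - p $ 1"
  have D: "dual_line q x - dual_line p x = u - v * x" for x
    by (simp add: dual_line_def u_def v_def algebra_simps)
  have "(u - v * a) * (u - v * b) < 0 \<longleftrightarrow> v \<noteq> 0 \<and> (\<exists>x. a < x \<and> x < b \<and> u - v * x = 0)"
  proof
    assume neg: "(u - v * a) * (u - v * b) < 0"
    have v: "v \<noteq> 0"
    proof
      assume "v = 0"
      then show False using neg by (simp add: not_less flip: power2_eq_square)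
    qed
    define x where "x = u / v"
    have u: "u = v * x" using v by (simp add: x_def)
    have "(v * v) * ((x - a) * (x - b)) < 0" using neg by (simp add: u algebra_simps)
    moreover have "v * v > 0" using v by (simp add: not_square_less_zero less_le)
    ultimately have "(x - a) * (x - b) < 0" by (simp add: mult_less_0_iff)
    then have "a < x \<and> x < b" using assms by (auto simp: mult_less_0_iff)
    then show "v \<noteq> 0 \<and> (\<exists>x. a < x \<and> x < b \<and> u - v * x = 0)" using v u by auto
  next
    assume "v \<noteq> 0 \<and> (\<exists>x. a < x \<and> x < b \<and> u - v * x = 0)"
    then obtain x where v: "v \<noteq> 0" and x: "a < x" "x < b" "u = v * x" by auto
    have "(u - v * a) * (u - v * b) = (v * v) * ((x - a) * (x - b))"
      by (simp add: x algebra_simps)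
    moreover have "v * v > 0" using v by (simp add: not_square_less_zero less_le)
    moreover have "(x - a) * (x - b) < 0" using x by (simp add: mult_less_0_iff)
    ultimately show "(u - v * a) * (u - v * b) < 0" by (simp add: mult_less_0_iff)
  qed
  moreover have "dual_line q x = dual_line p x \<longleftrightarrow> u - v * x = 0" for x
    using D[of x] by linarith
  moreover have "q $ 1 \<noteq> p $ 1 \<longleftrightarrow> v \<noteq> 0" by (simp add: v_def)
  ultimately show ?thesis by (simp add: wedge_points_def D)
qed

lemma dual_line_unique:
  assumes "dual_line q x = dual_line p x" "dual_line q y = dual_line p y" "q \<noteq> p"
  shows "x = y"
proof (rule ccontr)
  assume "x \<noteq> y"
  have "(q $ 1 - p $ 1) * (x - y) = 0" using assms by (simp add: dual_line_def algebra_simps)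
  then have "q $ 1 = p $ 1" using \<open>x \<noteq> y\<close> by simp
  moreover from this have "q $ 2 = p $ 2" using assms(1) by (simp add: dual_line_def)
  ultimately show False using assms(3) by (simp add: vec2_eq_iff)
qed

text \<open>The dual lines of \<open>q\<close> and \<open>p\<close> meet over a single abscissa,
  which lies in at most one gap between consecutive slopes.\<close>

lemma wedge_points_disjoint:
  assumes "ab \<in> consecutive_slopes L p" "cd \<in> consecutive_slopes L p" "ab \<noteq> cd"
  shows "wedge_points P p ab \<inter> wedge_points P p cd = {}"
proof (rule ccontr)
  assume "wedge_points P p ab \<inter> wedge_points P p cd \<noteq> {}"
  then obtain q where q: "q \<in> wedge_points P p ab" "q \<in> wedge_points P p cd" by auto
  obtain a b c d where ab: "ab = (a, b)" "cd = (c, d)" by (metis surj_pair)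
  have "a < b" "c < d" using assms ab by (auto simp: consecutive_slopes_def)
  then obtain x y where x: "a < x" "x < b" "dual_line q x = dual_line p x"
      and y: "c < y" "y < d" "dual_line q y = dual_line p y" and "q \<noteq> p"
    using q by (auto simp: ab wedge_points_iff)
  then have "x = y" using dual_line_unique by blast
  then show False
    using consecutive_slopes_overlap[of a b L p c d x] assms x y by (simp add: ab)
qed

lemma sum_card_wedge_points_le:
  assumes "finite L" "finite P" "S \<subseteq> consecutive_slopes L p"
  shows "(\<Sum>ab\<in>S. card (wedge_points P p ab)) \<le> card P"
proof -
  have "finite S" using assms finite_consecutive_slopes finite_subset by blast
  then have "(\<Sum>ab\<in>S. card (wedge_points P p ab)) = card (\<Union>ab\<in>S. wedge_points P p ab)"
  proof (intro card_UN_disjoint[symmetric])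
    show "\<forall>ab\<in>S. \<forall>cd\<in>S. ab \<noteq> cd \<longrightarrow> wedge_points P p ab \<inter> wedge_points P p cd = {}"
      using wedge_points_disjoint assms(3) by blast
  qed (auto simp: wedge_points_def assms)
  also have "\<dots> \<le> card P" using assms by (intro card_mono) (auto simp: wedge_points_def)
  finally show ?thesis .
qed

lemma card_le_if_many_wedge_points:
  assumes "finite L" "finite P" "S \<subseteq> consecutive_slopes L p"
    and "\<And>ab. ab \<in> S \<Longrightarrow> k \<le> real (card (wedge_points P p ab))"
  shows "k * real (card S) \<le> real (card P)"
proof -
  have "k * real (card S) = (\<Sum>ab\<in>S. k)" by simp
  also have "\<dots> \<le> (\<Sum>ab\<in>S. real (card (wedge_points P p ab)))" by (intro sum_mono assms)
  also have "\<dots> \<le> real (card P)"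
    using sum_card_wedge_points_le[OF assms(1-3)] by (metis of_nat_le_iff of_nat_sum)
  finally show ?thesis .
qed

text \<open>In the basis \<open>u\<close>, \<open>v\<close> the coordinates of \<open>q - p\<close>
  are, up to nonzero factors, the heights of \<open>q\<close> over the two lines. The sign of
  \<open>u $ 1 * v $ 1\<close> tells which of the two double wedges is meant.\<close>

lemma double_wedge_eq:
  assumes "u $ 2 = a * u $ 1" "v $ 2 = b * v $ 1" "u $ 1 \<noteq> 0" "v $ 1 \<noteq> 0" "a \<noteq> b"
  shows "double_wedge p u v = {q. (dual_line q a - dual_line p a) * (dual_line q b - dual_line p b) *
    (u $ 1 * v $ 1) < 0}"
proof (intro set_eqI iffI)
  fix q assume "q \<in> double_wedge p u v"
  then obtain s t where q: "q = p + s *\<^sub>R u + t *\<^sub>R v" and st: "s * t > 0"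
    by (auto simp: double_wedge_def)
  have "dual_line q a - dual_line p a = (b - a) * (t * v $ 1)"
      "dual_line q b - dual_line p b = - (b - a) * (s * u $ 1)"
    by (simp_all add: q dual_line_def assms algebra_simps)
  then have "(dual_line q a - dual_line p a) * (dual_line q b - dual_line p b) * (u $ 1 * v $ 1)
      = - ((s * t) * ((b - a) * u $ 1 * v $ 1)\<^sup>2)"
    by (simp only: power2_eq_square) (simp add: algebra_simps)
  moreover have "(s * t) * ((b - a) * u $ 1 * v $ 1)\<^sup>2 > 0"
    using assms by (intro mult_pos_pos[OF st]) auto
  ultimately show "q \<in> {q. (dual_line q a - dual_line p a) * (dual_line q b - dual_line p b) *
    (u $ 1 * v $ 1) < 0}" by simp
next
  fix q assume "q \<in> {q. (dual_line q a - dual_line p a) * (dual_line q b - dual_line p b) *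
    (u $ 1 * v $ 1) < 0}"
  then have neg: "(dual_line q a - dual_line p a) * (dual_line q b - dual_line p b) *
    (u $ 1 * v $ 1) < 0" by simp
  define s where "s = (dual_line q b - dual_line p b) / ((a - b) * u $ 1)"
  define t where "t = (dual_line q a - dual_line p a) / ((b - a) * v $ 1)"
  have s: "dual_line q b - dual_line p b = (a - b) * (s * u $ 1)"
    and t: "dual_line q a - dual_line p a = (b - a) * (t * v $ 1)"
    using assms by (simp_all add: s_def t_def)
  have "(a - b) * (q $ 1 - p $ 1) = (a - b) * (s * u $ 1 + t * v $ 1)"
    using s t by (simp add: dual_line_def algebra_simps)
  then have q1: "q $ 1 - p $ 1 = s * u $ 1 + t * v $ 1" using assms(5) by simp
  have "q $ 2 - p $ 2 = (dual_line q a - dual_line p a) + a * (q $ 1 - p $ 1)"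
    by (simp add: dual_line_def algebra_simps)
  also have "\<dots> = s * u $ 2 + t * v $ 2"
    unfolding q1 t by (simp add: assms algebra_simps)
  finally have "q = p + s *\<^sub>R u + t *\<^sub>R v" using q1 by (simp add: vec2_eq_iff)
  moreover have "(dual_line q a - dual_line p a) * (dual_line q b - dual_line p b) * (u $ 1 * v $ 1)
      = - ((s * t) * ((b - a) * u $ 1 * v $ 1)\<^sup>2)"
    unfolding s t by (simp add: power2_eq_square algebra_simps)
  then have "0 < (s * t) * ((b - a) * u $ 1 * v $ 1)\<^sup>2" using neg by simp
  then have "s * t > 0" by (metis mult_less_cancel_right_disj mult_zero_left power2_less_0)
  ultimately show "q \<in> double_wedge p u v" by (auto simp: double_wedge_def)
qed

text \<open>The third line through \<open>p\<close> runs inside the double wedge around the vertical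
  direction, so only the one described by \<open>wedge_points\<close> is empty.\<close>

lemma points_between_eq:
  assumes lines: "\<forall>l\<in>L. is_line l" and ab: "(a, b) \<in> consecutive_slopes L p"
    and third: "c \<in> slopes L p" "c \<noteq> a" "c \<noteq> b"
  defines "l \<equiv> graph_line a (dual_line p a)" and "l' \<equiv> graph_line b (dual_line p b)"
  shows "consecutive_lines L p l l' \<and> points_between P L p l l' = wedge_points P p (a, b)"
proof -
  define D where "D q = (dual_line q a - dual_line p a) * (dual_line q b - dual_line p b)" for q
  have less: "a < b" and L: "l \<in> L" "l' \<in> L"
    and gap: "\<And>c. c \<in> slopes L p \<Longrightarrow> \<not> (a < c \<and> c < b)"
    using ab by (auto simp: consecutive_slopes_def slopes_def l_def l'_def)
  have ne: "l \<noteq> l'" using less by (simp add: l_def l'_def graph_line_eq_iff)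
  have wedge: "double_wedge p u v = (if u $ 1 * v $ 1 > 0 then {q. D q < 0} else {q. D q > 0})
      \<and> u $ 1 * v $ 1 \<noteq> 0"
    if uv: "u \<noteq> 0" "v \<noteq> 0" "p + u \<in> l" "p + v \<in> l'" for u v
  proof -
    have u2: "u $ 2 = a * u $ 1" "v $ 2 = b * v $ 1"
      using uv by (simp_all add: l_def l'_def mem_graph_line_iff dual_line_def algebra_simps)
    moreover have "u $ 1 \<noteq> 0" "v $ 1 \<noteq> 0" using u2 uv by (auto simp: vec2_eq_iff)
    ultimately show ?thesis
      using less by (auto simp: double_wedge_eq D_def mult_less_0_iff zero_less_mult_iff)
  qed
  have D_line: "D q = (c - a) * (c - b) * (q $ 1 - p $ 1)\<^sup>2" if "q \<in> graph_line c (dual_line p c)" for q c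
  proof -
    have q2: "q $ 2 = p $ 2 + c * (q $ 1 - p $ 1)"
      using that by (simp add: graph_line_def dual_line_def algebra_simps)
    show ?thesis by (simp add: D_def dual_line_def q2 power2_eq_square algebra_simps)
  qed
  have "empty_double_wedges L p l l' = {{q. D q < 0}}"
  proof (intro equalityI subsetI)
    fix W assume W: "W \<in> empty_double_wedges L p l l'"
    then obtain u v where "W = double_wedge p u v" "u \<noteq> 0" "v \<noteq> 0" "p + u \<in> l" "p + v \<in> l'"
      unfolding empty_double_wedges_def double_wedges_def by blast
    then have "W = {q. D q < 0} \<or> W = {q. D q > 0}"
      using wedge[of u v] by presburger
    moreover have "W \<noteq> {q. D q > 0}"
    proof
      assume W': "W = {q. D q > 0}"
      \<comment> \<open>A point of the third line other than \<open>p\<close>; it shows that this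
        line meets the double wedge \<open>D > 0\<close>.\<close>
      define q where "q = p + vector [1, c]"
      have q: "q \<in> graph_line c (dual_line p c)"
        by (simp add: q_def mem_graph_line_iff dual_line_def algebra_simps)
      have "D q = (c - a) * (c - b)" unfolding D_line[OF q] by (simp add: q_def)
      moreover have "(c - a) * (c - b) > 0"
        using gap[OF third(1)] third less by (auto simp: zero_less_mult_iff)
      ultimately have "q \<in> W" using W' by simp
      moreover have "graph_line c (dual_line p c) \<in> L - {l, l'}"
        using third by (simp add: slopes_def l_def l'_def graph_line_eq_iff)
      moreover have "p \<in> graph_line c (dual_line p c)" by (simp add: mem_graph_line_iff)
      ultimately show False using W q by (auto simp: empty_double_wedges_def)
    qed
    ultimately show "W \<in> {{q. D q < 0}}" by simp
  next
    fix W assume "W \<in> {{q. D q < 0}}"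
    then have W: "W = {q. D q < 0}" by simp
    define u v :: "real ^ 2" where "u = vector [1, a]" and "v = vector [1, b]"
    have uv: "u \<noteq> 0" "v \<noteq> 0" "p + u \<in> l" "p + v \<in> l'" "u $ 1 * v $ 1 > 0"
      by (simp_all add: u_def v_def l_def l'_def mem_graph_line_iff dual_line_def algebra_simps vec2_eq_iff)
    have "W \<in> double_wedges p l l'"
      unfolding double_wedges_def using wedge[OF uv(1-4)] uv W by auto
    moreover have "W \<inter> m = {}" if "m \<in> L - {l, l'}" "p \<in> m" for m
    proof -
      have "is_line m" "m \<in> L" using that lines by auto
      then have "D q \<ge> 0" if "q \<in> m" for q
        using \<open>p \<in> m\<close>
      proof (cases rule: line_through_cases)
        case (graph c)
        then have "(c - a) * (c - b) \<ge> 0" using gap[of c] less by (auto simp: zero_le_mult_iff)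
        then show ?thesis using D_line[of q c] that graph by simp
      next
        case vertical
        \<comment> \<open>On the vertical line both heights agree, so \<open>D\<close> is a
          square.\<close>
        then have "D q = (q $ 2 - p $ 2)\<^sup>2"
          using that by (simp add: D_def dual_line_def power2_eq_square)
        then show ?thesis by simp
      qed
      then show ?thesis by (force simp: W)
    qed
    ultimately show "W \<in> empty_double_wedges L p l l'" by (auto simp: empty_double_wedges_def)
  qed
  then show ?thesis
    using L ne unfolding consecutive_lines_def points_between_def
    by (auto simp: l_def l'_def mem_graph_line_iff wedge_points_def D_def)
qed

section \<open>Counting wedges\<close>

text \<open>Vertices are the dual points of non-vertical lines, and an edge
  \<open>(p, (a, b))\<close> is the piece of the dual line of \<open>p\<close> over the gap from
  \<open>a\<close> to \<open>b\<close>. A vertex inside an edge would be an intermediate slope, and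
  two edges with the same ends would lie on the same dual line.\<close>

lemma dual_drawing:
  assumes "finite P" "finite L"
  shows "monotone_drawing {(m, b). graph_line m b \<in> L} (SIGMA p:P. consecutive_slopes L p)
    (\<lambda>e. fst (snd e)) (\<lambda>e. snd (snd e)) (\<lambda>e. dual_line (fst e))"
proof unfold_locales
  show "finite {(m, b). graph_line m b \<in> L}"
    by (rule inj_on_finite[of "\<lambda>(m, b). graph_line m b" _ L])
       (auto simp: inj_on_def graph_line_eq_iff assms)
  show "finite (SIGMA p:P. consecutive_slopes L p)"
    using assms finite_consecutive_slopes by blast
next
  fix e assume "e \<in> (SIGMA p:P. consecutive_slopes L p)"
  then show "fst (snd e) < snd (snd e)"
    "(fst (snd e), dual_line (fst e) (fst (snd e))) \<in> {(m, b). graph_line m b \<in> L}"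
    "(snd (snd e), dual_line (fst e) (snd (snd e))) \<in> {(m, b). graph_line m b \<in> L}"
    by (auto simp: consecutive_slopes_def slopes_def)
  show "continuous_on {fst (snd e)..snd (snd e)} (dual_line (fst e))"
    unfolding dual_line_def by (intro continuous_intros)
next
  fix e x y
  assume "e \<in> (SIGMA p:P. consecutive_slopes L p)" "(x, y) \<in> {(m, b). graph_line m b \<in> L}"
    "fst (snd e) < x" "x < snd (snd e)"
  then show "y \<noteq> dual_line (fst e) x" by (auto simp: consecutive_slopes_def slopes_def)
next
  fix e f
  assume ef: "e \<in> (SIGMA p:P. consecutive_slopes L p)" "f \<in> (SIGMA p:P. consecutive_slopes L p)"
    and eq: "fst (snd e) = fst (snd f)" "snd (snd e) = snd (snd f)"
      "dual_line (fst e) (fst (snd e)) = dual_line (fst f) (fst (snd f))"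
      "dual_line (fst e) (snd (snd e)) = dual_line (fst f) (snd (snd f))"
  have "fst (snd e) \<noteq> snd (snd e)" using ef by (auto simp: consecutive_slopes_def)
  then have "fst e = fst f"
    using dual_line_unique[of "fst e" "fst (snd e)" "fst f" "snd (snd e)"] eq by auto
  then show "e = f" using eq by (simp add: prod_eq_iff)
qed

text \<open>Edges with at most \<open>k\<close> wedge points form a drawing in which each edge has
  at most \<open>k\<close> crossings, so the crossing lemma bounds their number.\<close>

lemma card_few_wedge_points_le:
  assumes fin: "finite P" "finite L" and q: "q > 0" "2 * k \<le> (real q)\<^sup>2"
  shows "real (card {e \<in> (SIGMA p:P. consecutive_slopes L p). real (card (wedge_points P (fst e) (snd e))) \<le> k})
    \<le> 6 * real q * real (card L)"
proof -
  define V where "V = {(m, b). graph_line m b \<in> L}"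
  define E where "E = {e \<in> (SIGMA p:P. consecutive_slopes L p). real (card (wedge_points P (fst e) (snd e))) \<le> k}"
  interpret A: monotone_drawing V "SIGMA p:P. consecutive_slopes L p"
    "\<lambda>e. fst (snd e)" "\<lambda>e. snd (snd e)" "\<lambda>e. dual_line (fst e)"
    unfolding V_def using fin by (rule dual_drawing)
  interpret monotone_drawing V E "\<lambda>e. fst (snd e)" "\<lambda>e. snd (snd e)" "\<lambda>e. dual_line (fst e)"
    by (rule A.restrict) (use A.ends_subset in \<open>auto simp: E_def\<close>)
  have E: "fst e \<in> P" "snd e \<in> consecutive_slopes L (fst e)" "fst (snd e) < snd (snd e)" if "e \<in> E" for e
    using that by (auto simp: E_def consecutive_slopes_def)
  have crossing_point: "\<exists>x. fst (snd e) < x \<and> x < snd (snd e) \<and> fst (snd f) < x \<and> x < snd (snd f) \<and>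
      dual_line (fst e) x = dual_line (fst f) x" if "crosses e f" for e f
    using that by (auto simp: crosses_def)
  \<comment> \<open>Edges belonging to one point lie over disjoint open gaps.\<close>
  have diff: "fst e \<noteq> fst f" if "e \<in> E" "f \<in> E" "crosses e f" for e f
  proof
    assume eq: "fst e = fst f"
    obtain x where "fst (snd e) < x" "x < snd (snd e)" "fst (snd f) < x" "x < snd (snd f)"
      using crossing_point \<open>crosses e f\<close> by blast
    then have "snd e = snd f"
      using consecutive_slopes_overlap[of "fst (snd e)" "snd (snd e)" L "fst e" "fst (snd f)" "snd (snd f)" x]
        E[OF \<open>e \<in> E\<close>] E[OF \<open>f \<in> E\<close>] eq by simp
    then show False using eq \<open>crosses e f\<close> by (simp add: crosses_def prod_eq_iff)
  qed
  have "real (card E) \<le> 6 * real q * real (card V)"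
  proof (rule card_edges_le_if_few_crossings[OF _ _ q])
    fix e f assume ef: "e \<in> E" "f \<in> E" and cr: "crosses e f"
    show "ends e \<inter> ends f = {}"
    proof (rule ccontr)
      assume "ends e \<inter> ends f \<noteq> {}"
      then obtain y where y: "dual_line (fst e) y = dual_line (fst f) y"
        "y = fst (snd e) \<or> y = snd (snd e)"
        unfolding ends_def by (smt (verit) disjoint_iff insert_iff prod.inject singletonD)
      obtain x where x: "fst (snd e) < x" "x < snd (snd e)" "dual_line (fst e) x = dual_line (fst f) x"
        using crossing_point[OF cr] by blast
      \<comment> \<open>Two dual lines meet only once, and the crossing already uses that point, in
        the interior of \<open>e\<close>.\<close>
      have "x = y" using dual_line_unique x y diff[OF ef cr] by blast
      then show False using x y by auto
    qed
  next
    fix e assume e: "e \<in> E"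
    \<comment> \<open>Send a crossing edge to its point: the dual line of that point meets the dual
      line of \<open>fst e\<close> only once, and only one of its edges is interior there.\<close>
    have "card {f \<in> E. crosses e f} \<le> card (wedge_points P (fst e) (snd e))"
    proof (rule card_inj_on_le)
      show "inj_on fst {f \<in> E. crosses e f}"
      proof (rule inj_onI)
        fix f g assume f: "f \<in> {f \<in> E. crosses e f}" and g: "g \<in> {f \<in> E. crosses e f}"
          and eq: "fst f = fst g"
        obtain x where x: "fst (snd f) < x" "x < snd (snd f)" "dual_line (fst e) x = dual_line (fst f) x"
          using f crossing_point by blast
        obtain y where y: "fst (snd g) < y" "y < snd (snd g)" "dual_line (fst e) y = dual_line (fst g) y"
          using g crossing_point by blast
        have "fst e \<noteq> fst f" using diff e f by auto
        then have "x = y" using dual_line_unique x y eq by metis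
        then have "snd f = snd g"
          using consecutive_slopes_overlap[of "fst (snd f)" "snd (snd f)" L "fst f" "fst (snd g)" "snd (snd g)" x]
            E[of f] E[of g] f g x y eq by simp
        then show "f = g" using eq by (simp add: prod_eq_iff)
      qed
      show "fst ` {f \<in> E. crosses e f} \<subseteq> wedge_points P (fst e) (snd e)"
      proof
        fix p assume "p \<in> fst ` {f \<in> E. crosses e f}"
        then obtain f where f: "f \<in> E" "crosses e f" "p = fst f" by auto
        obtain x where x: "fst (snd e) < x" "x < snd (snd e)" "dual_line (fst e) x = dual_line p x"
          using f crossing_point by blast
        have "p $ 1 \<noteq> fst e $ 1"
        proof
          assume eq: "p $ 1 = fst e $ 1"
          then have "p $ 2 = fst e $ 2" using x by (simp add: dual_line_def)
          then show False using eq diff[OF e f(1,2)] f(3) by (simp add: vec2_eq_iff)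
        qed
        then have "p \<in> wedge_points P (fst e) (fst (snd e), snd (snd e))"
          using E[OF e] E[OF f(1)] x f by (subst wedge_points_iff) auto
        then show "p \<in> wedge_points P (fst e) (snd e)" by simp
      qed
      show "finite (wedge_points P (fst e) (snd e))" using fin by (simp add: wedge_points_def)
    qed
    then show "real (card {f \<in> E. crosses e f}) \<le> k" using e by (simp add: E_def)
  qed
  moreover have "card V \<le> card L"
    by (rule card_inj_on_le[of "\<lambda>(m, b). graph_line m b"])
       (auto simp: V_def inj_on_def graph_line_eq_iff fin)
  then have "6 * real q * real (card V) \<le> 6 * real q * real (card L)"
    by (intro mult_left_mono) auto
  ultimately show ?thesis by (simp add: E_def)
qed

section \<open>From incidences to moderate wedges\<close>

lemma incidences_eq_sum:
  assumes "finite P" "finite L"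
  shows "incidences P L = (\<Sum>p\<in>P. card {l \<in> L. p \<in> l})"
proof -
  have "{(p, l). p \<in> P \<and> l \<in> L \<and> p \<in> l} = (SIGMA p:P. {l \<in> L. p \<in> l})" by auto
  then show ?thesis using assms by (simp add: incidences_def)
qed

text \<open>Each point loses at most two incidences: its vertical line and its largest
  slope.\<close>

lemma incidences_le:
  assumes "finite P" "finite L" "\<forall>l\<in>L. is_line l"
  shows "incidences P L \<le> card (SIGMA p:P. consecutive_slopes L p) + 2 * card P"
proof -
  have "incidences P L \<le> (\<Sum>p\<in>P. card (consecutive_slopes L p) + 2)"
    unfolding incidences_eq_sum[OF assms(1,2)]
  proof (rule sum_mono)
    fix p
    show "card {l \<in> L. p \<in> l} \<le> card (consecutive_slopes L p) + 2"
      using card_lines_through_le[OF assms(2,3), of p] card_slopes_le_consecutive[OF assms(2), of p]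
      by linarith
  qed
  also have "\<dots> = card (SIGMA p:P. consecutive_slopes L p) + 2 * card P"
    using assms finite_consecutive_slopes by (simp add: sum.distrib del: add_2_eq_Suc')
  finally show ?thesis .
qed

definition moderate_wedges ::
  "(real ^ 2) set \<Rightarrow> (real ^ 2) set set \<Rightarrow> real \<Rightarrow> real \<Rightarrow> real ^ 2 \<Rightarrow> (real \<times> real) set" where
  "moderate_wedges P L k K p =
     {ab \<in> consecutive_slopes L p. k \<le> real (card (wedge_points P p ab)) \<and> real (card (wedge_points P p ab)) \<le> K}"

lemma moderate_wedges_subset: "moderate_wedges P L k K p \<subseteq> consecutive_slopes L p"
  by (auto simp: moderate_wedges_def)

text \<open>Wedges are split into poor, rich and moderate ones. The crossing lemma bounds the poor
  ones in total; disjointness allows at most \<open>card P / K\<close> rich ones per point.\<close>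

lemma incidences_le_moderate:
  assumes fin: "finite P" "finite L" and lines: "\<forall>l\<in>L. is_line l"
    and q: "q > 0" "2 * k \<le> (real q)\<^sup>2" and "K > 0"
  shows "real (incidences P L) \<le> (\<Sum>p\<in>P. real (card (moderate_wedges P L k K p)))
    + 6 * real q * real (card L) + real (card P) * (real (card P) / K) + 2 * real (card P)"
proof -
  define S where "S = (SIGMA p:P. consecutive_slopes L p)"
  define few where "few = {e \<in> S. real (card (wedge_points P (fst e) (snd e))) \<le> k}"
  define many where "many = (SIGMA p:P. {ab \<in> consecutive_slopes L p. K \<le> real (card (wedge_points P p ab))})"
  define moderate where "moderate = (SIGMA p:P. moderate_wedges P L k K p)"
  have finS: "finite S" using fin finite_consecutive_slopes unfolding S_def by blast
  have sub: "few \<subseteq> S" "many \<subseteq> S" "moderate \<subseteq> S"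
    by (auto simp: few_def many_def moderate_def moderate_wedges_def S_def)
  have "S \<subseteq> moderate \<union> (few \<union> many)"
    by (auto simp: few_def many_def moderate_def moderate_wedges_def S_def)
  then have "card S \<le> card (moderate \<union> (few \<union> many))"
    using sub finS by (intro card_mono) (auto intro: finite_subset)
  also have "\<dots> \<le> card moderate + (card few + card many)"
    by (meson add_left_mono card_Un_le le_trans)
  finally have "card S \<le> card moderate + (card few + card many)" .
  moreover have "real (card few) \<le> 6 * real q * real (card L)"
    unfolding few_def S_def by (rule card_few_wedge_points_le[OF fin q])
  moreover have "real (card many) \<le> real (card P) * (real (card P) / K)"
  proof -
    have "card many = (\<Sum>p\<in>P. card {ab \<in> consecutive_slopes L p. K \<le> real (card (wedge_points P p ab))})"
      using fin finite_consecutive_slopes unfolding many_def by (intro card_SigmaI) auto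
    then have "real (card many) = (\<Sum>p\<in>P. real (card {ab \<in> consecutive_slopes L p. K \<le> real (card (wedge_points P p ab))}))"
      by simp
    also have "\<dots> \<le> (\<Sum>p\<in>P. real (card P) / K)"
    proof (rule sum_mono)
      fix p
      have "K * real (card {ab \<in> consecutive_slopes L p. K \<le> real (card (wedge_points P p ab))}) \<le> real (card P)"
        by (rule card_le_if_many_wedge_points[OF fin(2,1)]) auto
      then show "real (card {ab \<in> consecutive_slopes L p. K \<le> real (card (wedge_points P p ab))}) \<le> real (card P) / K"
        using \<open>K > 0\<close> by (simp add: field_simps)
    qed
    finally show ?thesis by simp
  qed
  moreover have "real (card moderate) = (\<Sum>p\<in>P. real (card (moderate_wedges P L k K p)))"
    unfolding moderate_def using fin finite_subset[OF moderate_wedges_subset finite_consecutive_slopes]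
    by (subst card_SigmaI) auto
  moreover have "incidences P L \<le> card S + 2 * card P"
    unfolding S_def by (rule incidences_le[OF fin lines])
  ultimately show ?thesis by linarith
qed

text \<open>Passes from slope pairs to unordered pairs of lines. A second consecutive pair supplies
  the third slope that identifies the double wedge.\<close>

lemma card_moderate_wedges_le:
  assumes fin: "finite L" and lines: "\<forall>l\<in>L. is_line l" and two: "2 \<le> card (consecutive_slopes L p)"
    and "k' \<le> k"
  shows "card (moderate_wedges P L k K p) \<le> card {{l, l'} | l l'. consecutive_lines L p l l' \<and>
    k' \<le> real (card (points_between P L p l l')) \<and> real (card (points_between P L p l l')) \<le> K}"
    (is "_ \<le> card ?pairs")
proof (rule card_inj_on_le)
  define ln where "ln m = graph_line m (dual_line p m)" for m
  define F where "F ab = {ln (fst ab), ln (snd ab)}" for ab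
  have ln: "ln a = ln b \<longleftrightarrow> a = b" for a b by (auto simp: ln_def graph_line_eq_iff)
  have less: "fst ab < snd ab" if "ab \<in> moderate_wedges P L k K p" for ab
    using that by (auto simp: moderate_wedges_def consecutive_slopes_def)
  show "inj_on F (moderate_wedges P L k K p)"
  proof (rule inj_onI)
    fix ab cd assume *: "ab \<in> moderate_wedges P L k K p" "cd \<in> moderate_wedges P L k K p" "F ab = F cd"
    then show "ab = cd"
      using less[OF *(1)] less[OF *(2)] by (auto simp: F_def doubleton_eq_iff ln prod_eq_iff)
  qed
  show "F ` moderate_wedges P L k K p \<subseteq> ?pairs"
  proof
    fix s assume "s \<in> F ` moderate_wedges P L k K p"
    then obtain a b where s: "s = {ln a, ln b}" and ab: "(a, b) \<in> consecutive_slopes L p"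
      and bounds: "k \<le> real (card (wedge_points P p (a, b)))" "real (card (wedge_points P p (a, b))) \<le> K"
      by (auto simp: F_def moderate_wedges_def)
    \<comment> \<open>Another consecutive pair \<open>(c, d)\<close> has
      \<open>c \<noteq> a\<close>; if \<open>c = b\<close>, then \<open>d\<close> lies beyond
      \<open>b\<close> and serves instead.\<close>
    have "\<exists>c \<in> slopes L p. c \<noteq> a \<and> c \<noteq> b"
    proof -
      have "\<not> consecutive_slopes L p \<subseteq> {(a, b)}"
        using two card_mono[of "{(a, b)}" "consecutive_slopes L p"] by auto
      then obtain c d where cd: "(c, d) \<in> consecutive_slopes L p" "(c, d) \<noteq> (a, b)" by auto
      then have "c \<noteq> a" using ab consecutive_slopes_same_fst by blast
      moreover have "c < d" "a < b" "c \<in> slopes L p" "d \<in> slopes L p"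
        using cd ab by (auto simp: consecutive_slopes_def)
      ultimately show ?thesis by (metis less_asym less_irrefl)
    qed
    then obtain c where "c \<in> slopes L p" "c \<noteq> a" "c \<noteq> b" by blast
    from points_between_eq[OF lines ab this, of P]
    have "consecutive_lines L p (ln a) (ln b)" "points_between P L p (ln a) (ln b) = wedge_points P p (a, b)"
      by (simp_all add: ln_def)
    moreover from this have "k' \<le> real (card (points_between P L p (ln a) (ln b)))"
      "real (card (points_between P L p (ln a) (ln b))) \<le> K"
      using bounds \<open>k' \<le> k\<close> by simp_all
    ultimately show "s \<in> ?pairs" unfolding s by blast
  qed
  have "?pairs \<subseteq> Pow L" by (auto simp: consecutive_lines_def)
  then show "finite ?pairs" using fin by (rule finite_subset[OF _ finite_Pow_iff[THEN iffD2]])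
qed

section \<open>Choice of constants and averaging over the points\<close>

theorem proposition4p4:
  fixes c :: real
  assumes "c > 0"
  shows "\<exists>c' C' :: real. \<exists>n0 :: nat. c' > 0 \<and> C' > 0 \<and>
    (\<forall>n \<ge> n0. \<forall>(P :: (real ^ 2) set) (L :: (real ^ 2) set set).
      finite P \<and> card P = n \<and> finite L \<and> card L = n \<and> (\<forall>l \<in> L. is_line l) \<and>
      real (incidences P L) \<ge> c * real n powr (4 / 3) \<longrightarrow>
      (\<exists>P' \<subseteq> P.
        real (card P') \<ge> c' * real n \<and>
        (\<forall>p \<in> P'. real (card {l \<in> L. p \<in> l}) \<ge> c' * real n powr (1 / 3)) \<and>
        real (card {p \<in> P'.
          real (card {{l, l'} | l l'. consecutive_lines L p l l' \<and>
              c' * real n powr (2 / 3) \<le> real (card (points_between P L p l l')) \<and>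
              real (card (points_between P L p l l')) \<le> C' * real n powr (2 / 3)})
            \<ge> c' * real n powr (1 / 3)}) \<ge> c' * real n))"
proof -
  \<comment> \<open>With \<open>t\<close> the cube root of \<open>n\<close>, poor and rich wedges
    may each cost \<open>c / 8 * t ^ 4\<close>. This dictates \<open>6 * \<delta> = c / 8\<close>
    and \<open>C' = 8 / c\<close>; \<open>\<epsilon>\<close> makes \<open>2 * k\<close> the square
    of \<open>\<delta> * t\<close>.\<close>
  define \<delta> where "\<delta> = c / 48"
  define \<epsilon> where "\<epsilon> = \<delta>\<^sup>2 / 2"
  define C' where "C' = 8 / c"
  \<comment> \<open>The three bounds serve, in order, the lower threshold for wedge points, the loss
    from points outside \<open>P'\<close>, and the size of \<open>P'\<close>.\<close>
  define c' where "c' = min \<epsilon> (min (c / 4) (\<epsilon> * c / 4))"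
  \<comment> \<open>Lower bound for \<open>t\<close>: \<open>32 / c\<close> absorbs the terms of
    order \<open>t ^ 3\<close>, and \<open>2 / c'\<close> gives every point of \<open>P'\<close> at
    least two consecutive pairs.\<close>
  define T where "T = max 1 (max (32 / c) (2 / c'))"
  define n0 where "n0 = nat \<lceil>T ^ 3\<rceil>"
  have \<delta>: "\<delta> > 0" and \<epsilon>: "\<epsilon> > 0" and C': "C' > 0" using assms by (auto simp: \<delta>_def \<epsilon>_def C'_def)
  have c': "c' > 0" "c' \<le> \<epsilon>" "c' \<le> c / 4" "c' \<le> \<epsilon> * c / 4" using assms \<epsilon> by (auto simp: c'_def)
  have main: "\<exists>P' \<subseteq> P.
        real (card P') \<ge> c' * real n \<and>
        (\<forall>p \<in> P'. real (card {l \<in> L. p \<in> l}) \<ge> c' * real n powr (1 / 3)) \<and>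
        real (card {p \<in> P'.
          real (card {{l, l'} | l l'. consecutive_lines L p l l' \<and>
              c' * real n powr (2 / 3) \<le> real (card (points_between P L p l l')) \<and>
              real (card (points_between P L p l l')) \<le> C' * real n powr (2 / 3)})
            \<ge> c' * real n powr (1 / 3)}) \<ge> c' * real n"
    if n: "n \<ge> n0" and fin: "finite P" "finite L" and card: "card P = n" "card L = n"
      and lines: "\<forall>l \<in> L. is_line l" and inc: "real (incidences P L) \<ge> c * real n powr (4 / 3)"
    for n and P :: "(real ^ 2) set" and L :: "(real ^ 2) set set"
  proof -
    define t where "t = real n powr (1 / 3)"
    have "T ^ 3 \<le> real n" using n unfolding n0_def by linarith
    moreover have "T \<ge> 1" by (simp add: T_def)
    ultimately have npos: "real n > 0" by (smt (verit) one_le_power)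
    have t3: "t ^ 3 = real n" and t2: "real n powr (2 / 3) = t ^ 2" and t4: "real n powr (4 / 3) = t ^ 4"
      using npos by (simp_all add: t_def powr_powr flip: powr_numeral)
    have "T \<le> t"
    proof (rule power_le_imp_le_base)
      show "T ^ Suc 2 \<le> t ^ Suc 2" using \<open>T ^ 3 \<le> real n\<close> t3 by (simp add: numeral_3_eq_3)
    qed (simp add: t_def)
    then have t: "t > 0" "32 / c \<le> t" "2 / c' \<le> t" using \<open>T \<ge> 1\<close> by (auto simp: T_def)
    then have t': "32 \<le> c * t" "2 \<le> c' * t" using assms c' by (simp_all add: field_simps)
    define k where "k = \<epsilon> * t\<^sup>2"
    define q where "q = nat \<lceil>\<delta> * t\<rceil>"
    define g where "g p = real (card (moderate_wedges P L k (C' * t\<^sup>2) p))" for p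
    define P' where "P' = {p \<in> P. c' * t \<le> g p}"
    have "k > 0" using \<epsilon> t by (simp add: k_def)
    have q: "q > 0" "\<delta> * t \<le> real q" "real q \<le> \<delta> * t + 1"
      using mult_pos_pos[OF \<delta> t(1)] unfolding q_def by linarith+
    have "2 * k = (\<delta> * t)\<^sup>2" by (simp add: k_def \<epsilon>_def power_mult_distrib)
    also have "\<dots> \<le> (real q)\<^sup>2" using q(2) \<delta> t by (intro power_mono) auto
    finally have kq: "2 * k \<le> (real q)\<^sup>2" .
    have "c * t ^ 4 \<le> sum g P + 6 * real q * t ^ 3 + t ^ 3 * (t ^ 3 / (C' * t\<^sup>2)) + 2 * t ^ 3"
      using incidences_le_moderate[OF fin lines q(1) kq, of "C' * t\<^sup>2"] inc C' t(1)
      by (simp add: card t3 t4 g_def)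
    moreover have "6 * real q * t ^ 3 \<le> c / 8 * t ^ 4 + 6 * t ^ 3"
    proof -
      have "6 * real q * t ^ 3 \<le> 6 * (\<delta> * t + 1) * t ^ 3"
        using q t by (intro mult_right_mono mult_left_mono) auto
      then show ?thesis by (simp add: \<delta>_def algebra_simps power4_eq_xxxx power3_eq_cube)
    qed
    moreover have "t ^ 3 * (t ^ 3 / (C' * t\<^sup>2)) = c / 8 * t ^ 4"
      using t assms by (simp add: C'_def field_simps power4_eq_xxxx power3_eq_cube power2_eq_square)
    moreover have "8 * t ^ 3 \<le> c / 4 * t ^ 4"
    proof -
      have "32 * t ^ 3 \<le> (c * t) * t ^ 3" using t' t by (intro mult_right_mono) auto
      then show ?thesis by (simp add: power4_eq_xxxx power3_eq_cube mult.assoc)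
    qed
    \<comment> \<open>Out of \<open>c\<close>, the losses are \<open>c / 8\<close> for poor wedges,
      \<open>c / 8\<close> for rich ones, and \<open>c / 4\<close> for \<open>8 * t ^ 3\<close>,
      made up of 6 from rounding \<open>q\<close> up and 2 from
      \<open>incidences_le\<close>.\<close>
    ultimately have sum_g: "c / 2 * t ^ 4 \<le> sum g P" by (simp add: algebra_simps)
    \<comment> \<open>Disjoint wedges with at least \<open>\<epsilon> * t\<^sup>2\<close> points
      each share \<open>t ^ 3\<close> points.\<close>
    have g_le: "g p \<le> t / \<epsilon>" for p
    proof -
      have "k * g p \<le> t ^ 3"
        unfolding g_def t3 card(1)[symmetric]
        by (rule card_le_if_many_wedge_points[OF fin(2,1) moderate_wedges_subset])
           (simp add: moderate_wedges_def)
      then have "t\<^sup>2 * (\<epsilon> * g p) \<le> t\<^sup>2 * t" by (simp add: k_def power2_eq_square power3_eq_cube algebra_simps)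
      then have "\<epsilon> * g p \<le> t" using t by simp
      then show ?thesis using \<epsilon> by (simp add: field_simps)
    qed
    \<comment> \<open>Points outside \<open>P'\<close> contribute less than \<open>c' * t\<close>
      each, in total at most half of the lower bound for \<open>sum g P\<close>; the rest must come
      from \<open>P'\<close>.\<close>
    have "sum g P \<le> (\<Sum>p\<in>P. (if p \<in> P' then t / \<epsilon> else 0) + c' * t)"
    proof (rule sum_mono)
      fix p assume "p \<in> P"
      have "0 \<le> c' * t" using c' t by simp
      then show "g p \<le> (if p \<in> P' then t / \<epsilon> else 0) + c' * t"
        using g_le[of p] \<open>p \<in> P\<close> by (auto simp: P'_def)
    qed
    also have "\<dots> = real (card P') * (t / \<epsilon>) + t ^ 3 * (c' * t)"
    proof -
      have "P \<inter> P' = P'" by (auto simp: P'_def)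
      then show ?thesis using fin by (simp add: sum.distrib sum.If_cases card t3)
    qed
    also have "t ^ 3 * (c' * t) = c' * t ^ 4" by (simp add: power4_eq_xxxx power3_eq_cube)
    finally have "c / 2 * t ^ 4 \<le> real (card P') * (t / \<epsilon>) + c' * t ^ 4" using sum_g by linarith
    moreover have "c' * t ^ 4 \<le> c / 4 * t ^ 4" using c' t by (intro mult_right_mono) auto
    ultimately have "c / 4 * t ^ 4 \<le> real (card P') * (t / \<epsilon>)" by linarith
    then have "t * (\<epsilon> * c / 4 * t ^ 3) \<le> t * real (card P')"
      using \<epsilon> by (simp add: field_simps power4_eq_xxxx power3_eq_cube)
    then have "\<epsilon> * c / 4 * real n \<le> real (card P')" using t by (simp add: t3)
    moreover have "c' * real n \<le> \<epsilon> * c / 4 * real n" using c' by (intro mult_right_mono) auto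
    ultimately have card_P': "c' * real n \<le> real (card P')" by simp
    have P'_iff: "2 \<le> card (consecutive_slopes L p) \<and> c' * t \<le> real (card (consecutive_slopes L p))"
      if "p \<in> P'" for p
    proof -
      have "g p \<le> real (card (consecutive_slopes L p))"
        unfolding g_def of_nat_le_iff
        by (intro card_mono finite_consecutive_slopes fin moderate_wedges_subset)
      then show ?thesis using that t' by (simp add: P'_def)
    qed
    have lines_P': "c' * t \<le> real (card {l \<in> L. p \<in> l})" if "p \<in> P'" for p
      using P'_iff[OF that] card_consecutive_slopes_le[OF fin(2), of p] card_slopes_le[OF fin(2), of p]
      by linarith
    have "c' * t \<le> real (card {{l, l'} | l l'. consecutive_lines L p l l' \<and>
              c' * t\<^sup>2 \<le> real (card (points_between P L p l l')) \<and>
              real (card (points_between P L p l l')) \<le> C' * t\<^sup>2})" if "p \<in> P'" for p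
    proof -
      have "c' * t\<^sup>2 \<le> k" unfolding k_def using c' by (intro mult_right_mono) auto
      then show ?thesis
        using card_moderate_wedges_le[OF fin(2) lines, of p "c' * t\<^sup>2" k P "C' * t\<^sup>2"] P'_iff[OF that] that
        unfolding P'_def g_def by (smt (verit) mem_Collect_eq of_nat_mono)
    qed
    \<comment> \<open>Every point of \<open>P'\<close> has enough moderate pairs, so the required
      subset of \<open>P'\<close> is \<open>P'\<close> itself.\<close>
    then have "{p \<in> P'. c' * t \<le> real (card {{l, l'} | l l'. consecutive_lines L p l l' \<and>
              c' * t\<^sup>2 \<le> real (card (points_between P L p l l')) \<and>
              real (card (points_between P L p l l')) \<le> C' * t\<^sup>2})} = P'" by blast
    then show ?thesis
      unfolding t2 t_def[symmetric]
      using card_P' lines_P' by (intro exI[of _ P']) (auto simp: P'_def)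
  qed
  then show ?thesis using c' C' by blast
qed

end
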